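(* Let $G$ be an $n$-vertex graph of maximum degree $4$, let $S$ be an $n \times n$ grid point set, and let $\mu$ be a bijection from the vertex set of $G$ to $S$. One can test in $O(n)$ time whether $G$ admits a $\mu$-respecting restricted RAC$_1$ embedding on $S$ and, if so, construct such an embedding within the same time bound.
   Context: An $n \times n$ grid point set is a set $S$ of $n$ points with integer coordinates in $\{1,\dots,n\}^2$ such that no two points of $S$ lie on a common horizontal or a common vertical line. A point-set embedding of $G=(V,E)$ on $S$ consists of a bijection $V \to S$ and a polyline drawing of $G$ with each vertex at its assigned point and each edge a polygonal chain between its endpoints' points; edges may not overlap (share a segment of positive length) and may not pass through points representing other vertices. It is $\mu$-respecting if the bijection used is the given $\mu$. A restricted RAC$_1$ embedding is such an embedding in which every bend lies on an integer grid point, every edge segment is horizontal or vertical, every edge has at most one bend, and any two crossing edges cross at a right angle. *)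

theory Defs
  imports "HOL-Analysis.Analysis" "HOL-Library.Landau_Symbols"
begin

section \<open>Graphs and grid point sets\<close>

definition simple_graph :: "'v set \<Rightarrow> 'v set set \<Rightarrow> bool" where
  "simple_graph V E \<longleftrightarrow> finite V \<and> (\<forall>e\<in>E. e \<subseteq> V \<and> card e = 2)"

definition vertex_degree :: "'v set set \<Rightarrow> 'v \<Rightarrow> nat" where
  "vertex_degree E v = card {e \<in> E. v \<in> e}"

definition grid_point_set :: "nat \<Rightarrow> (nat \<times> nat) set \<Rightarrow> bool" where
  "grid_point_set n S \<longleftrightarrow>
     S \<subseteq> {1..n} \<times> {1..n} \<and> card S = n \<and>
     (\<forall>p\<in>S. \<forall>q\<in>S. p \<noteq> q \<longrightarrow> fst p \<noteq> fst q \<and> snd p \<noteq> snd q)"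


section \<open>Polyline drawings and restricted RAC1 embeddings\<close>

type_synonym point = "real \<times> real"

definition pt :: "nat \<times> nat \<Rightarrow> point" where
  "pt p = (real (fst p), real (snd p))"

text \<open>A polygonal chain is the list of its corners; the inner corners are its bends.\<close>

definition segments :: "point list \<Rightarrow> (point \<times> point) list" where
  "segments ps = zip ps (tl ps)"

definition bends :: "point list \<Rightarrow> point list" where
  "bends ps = butlast (tl ps)"

definition polygonal_chain :: "point list \<Rightarrow> bool" where
  "polygonal_chain ps \<longleftrightarrow> length ps \<ge> 2 \<and> (\<forall>(a, b) \<in> set (segments ps). a \<noteq> b)"

definition chain_image :: "point list \<Rightarrow> point set" where
  "chain_image ps = (\<Union>(a, b) \<in> set (segments ps). closed_segment a b)"

definition overlap :: "point list \<Rightarrow> point list \<Rightarrow> bool" where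
  "overlap ps qs \<longleftrightarrow>
     (\<exists>a b. a \<noteq> b \<and> closed_segment a b \<subseteq> chain_image ps \<inter> chain_image qs)"

text \<open>A drawing maps every edge to a polygonal chain; the vertices are placed by \<open>\<mu>\<close>.\<close>

definition point_set_embedding ::
    "'v set \<Rightarrow> 'v set set \<Rightarrow> (nat \<times> nat) set \<Rightarrow> ('v \<Rightarrow> nat \<times> nat) \<Rightarrow> ('v set \<Rightarrow> point list) \<Rightarrow> bool"
  where
  "point_set_embedding V E S \<mu> D \<longleftrightarrow>
     bij_betw \<mu> V S \<and>
     (\<forall>e\<in>E. polygonal_chain (D e) \<and> {hd (D e), last (D e)} = pt ` \<mu> ` e) \<and>
     (\<forall>e\<in>E. \<forall>f\<in>E. e \<noteq> f \<longrightarrow> \<not> overlap (D e) (D f)) \<and>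
     (\<forall>e\<in>E. \<forall>v\<in>V - e. pt (\<mu> v) \<notin> chain_image (D e))"

text \<open>A crossing of two edges is a common point that does not represent a common end vertex.
  If a bend lies on another edge, then both segments at the bend have to be
  perpendicular to that edge.\<close>

definition right_angle_crossings ::
    "'v set set \<Rightarrow> ('v \<Rightarrow> nat \<times> nat) \<Rightarrow> ('v set \<Rightarrow> point list) \<Rightarrow> bool" where
  "right_angle_crossings E \<mu> D \<longleftrightarrow>
     (\<forall>e\<in>E. \<forall>f\<in>E. e \<noteq> f \<longrightarrow>
        (\<forall>(a, b) \<in> set (segments (D e)). \<forall>(c, d) \<in> set (segments (D f)).
           \<forall>p \<in> closed_segment a b \<inter> closed_segment c d.
             p \<notin> pt ` \<mu> ` (e \<inter> f) \<longrightarrow> (b - a) \<bullet> (d - c) = 0))"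

definition restricted_RAC1_embedding ::
    "'v set \<Rightarrow> 'v set set \<Rightarrow> (nat \<times> nat) set \<Rightarrow> ('v \<Rightarrow> nat \<times> nat) \<Rightarrow> ('v set \<Rightarrow> point list) \<Rightarrow> bool"
  where
  "restricted_RAC1_embedding V E S \<mu> D \<longleftrightarrow>
     point_set_embedding V E S \<mu> D \<and>
     (\<forall>e\<in>E. (\<forall>b \<in> set (bends (D e)). fst b \<in> \<int> \<and> snd b \<in> \<int>) \<and>
            (\<forall>(a, b) \<in> set (segments (D e)). fst a = fst b \<or> snd a = snd b) \<and>
            length (bends (D e)) \<le> 1) \<and>
     right_angle_crossings E \<mu> D"


section \<open>Machine model\<close>

text \<open>Linear time refers to a word RAM, presented as a while language over natural numbers with
  scalar registers and random access arrays. Subtraction is truncated, and there is no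
  multiplication. Every operation takes one time unit.\<close>

type_synonym state = "(string \<Rightarrow> nat) \<times> (string \<Rightarrow> nat \<Rightarrow> nat)"

datatype aexp =
    Const nat
  | Var string
  | Read string aexp
  | Add aexp aexp
  | Sub aexp aexp

datatype bexp =
    Less aexp aexp
  | Equal aexp aexp
  | Neg bexp
  | Conj bexp bexp

datatype com =
    Skip
  | Assign string aexp
  | Store string aexp aexp
  | Seq com com
  | Cond bexp com com
  | While bexp com

primrec aval :: "aexp \<Rightarrow> state \<Rightarrow> nat" where
  "aval (Const k) s = k"
| "aval (Var x) s = fst s x"
| "aval (Read a i) s = snd s a (aval i s)"
| "aval (Add e f) s = aval e s + aval f s"
| "aval (Sub e f) s = aval e s - aval f s"

primrec bval :: "bexp \<Rightarrow> state \<Rightarrow> bool" where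
  "bval (Less e f) s \<longleftrightarrow> aval e s < aval f s"
| "bval (Equal e f) s \<longleftrightarrow> aval e s = aval f s"
| "bval (Neg b) s \<longleftrightarrow> \<not> bval b s"
| "bval (Conj b c) s \<longleftrightarrow> bval b s \<and> bval c s"

primrec acost :: "aexp \<Rightarrow> nat" where
  "acost (Const k) = 1"
| "acost (Var x) = 1"
| "acost (Read a i) = 1 + acost i"
| "acost (Add e f) = 1 + acost e + acost f"
| "acost (Sub e f) = 1 + acost e + acost f"

primrec bcost :: "bexp \<Rightarrow> nat" where
  "bcost (Less e f) = 1 + acost e + acost f"
| "bcost (Equal e f) = 1 + acost e + acost f"
| "bcost (Neg b) = 1 + bcost b"
| "bcost (Conj b c) = 1 + bcost b + bcost c"

text \<open>\<open>exec w c s t s'\<close>: with machine words holding the values \<open>0, \<dots>, w\<close>, the command \<open>c\<close>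
  started in \<open>s\<close> halts in \<open>s'\<close> after \<open>t\<close> time units. A command that stores a larger value is stuck.
  Values of subexpressions and addresses need no separate bound: a fixed expression evaluated in
  a state of words has a value of at most a constant multiple of \<open>w + 1\<close>.\<close>

inductive exec :: "nat \<Rightarrow> com \<Rightarrow> state \<Rightarrow> nat \<Rightarrow> state \<Rightarrow> bool" for w :: nat where
  exec_Skip: "exec w Skip s 1 s"
| exec_Assign: "aval e s \<le> w \<Longrightarrow>
    exec w (Assign x e) s (1 + acost e) ((fst s)(x := aval e s), snd s)"
| exec_Store: "aval e s \<le> w \<Longrightarrow>
    exec w (Store a i e) s (1 + acost i + acost e)
      (fst s, (snd s)(a := (snd s a)(aval i s := aval e s)))"
| exec_Seq: "exec w c s t s' \<Longrightarrow> exec w d s' t' s'' \<Longrightarrow> exec w (Seq c d) s (t + t') s''"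
| exec_CondT: "bval b s \<Longrightarrow> exec w c s t s' \<Longrightarrow> exec w (Cond b c d) s (1 + bcost b + t) s'"
| exec_CondF: "\<not> bval b s \<Longrightarrow> exec w d s t s' \<Longrightarrow> exec w (Cond b c d) s (1 + bcost b + t) s'"
| exec_WhileF: "\<not> bval b s \<Longrightarrow> exec w (While b c) s (1 + bcost b) s"
| exec_WhileT: "bval b s \<Longrightarrow> exec w c s t s' \<Longrightarrow> exec w (While b c) s' t' s'' \<Longrightarrow>
    exec w (While b c) s (1 + bcost b + t + t') s''"

inductive_cases exec_SkipE: "exec w Skip s t s'"
inductive_cases exec_AssignE: "exec w (Assign x e) s t s'"
inductive_cases exec_StoreE: "exec w (Store a i e) s t s'"
inductive_cases exec_SeqE: "exec w (Seq c d) s t s'"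
inductive_cases exec_CondE: "exec w (Cond b c d) s t s'"
inductive_cases exec_WhileE: "exec w (While b c) s t s'"

lemma exec_deterministic:
  "exec w c s t s' \<Longrightarrow> exec w c s u s'' \<Longrightarrow> u = t \<and> s'' = s'"
proof (induction arbitrary: u s'' rule: exec.induct)
  case (exec_Skip s)
  from exec_Skip.prems show ?case by (rule exec_SkipE) simp
next
  case (exec_Assign e s x)
  from exec_Assign.prems show ?case by (rule exec_AssignE) simp
next
  case (exec_Store e s a i)
  from exec_Store.prems show ?case by (rule exec_StoreE) simp
next
  case (exec_Seq c s t s' d t' s2)
  from exec_Seq.prems show ?case
    by (rule exec_SeqE) (metis exec_Seq.IH)
next
  case (exec_CondT b s c t s' d)
  from exec_CondT.prems show ?case
    by (rule exec_CondE) (metis exec_CondT.IH exec_CondT.hyps(1) plus_1_eq_Suc add_Suc)+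
next
  case (exec_CondF b s d t s' c)
  from exec_CondF.prems show ?case
    by (rule exec_CondE) (metis exec_CondF.IH exec_CondF.hyps(1) plus_1_eq_Suc add_Suc)+
next
  case (exec_WhileF b s c)
  from exec_WhileF.prems show ?case
    by (rule exec_WhileE) (simp_all add: exec_WhileF.hyps)
next
  case (exec_WhileT b s c t s' t' s2)
  from exec_WhileT.prems show ?case
    by (rule exec_WhileE) (metis exec_WhileT.IH exec_WhileT.hyps(1) plus_1_eq_Suc add_Suc)+
qed


section \<open>Input and output\<close>

text \<open>The vertices and the edges are listed in an arbitrary order, each exactly once, and every edge
  is a pair of vertex indices in an arbitrary orientation.\<close>

definition decode_edge :: "'v list \<Rightarrow> nat \<times> nat \<Rightarrow> 'v set" where
  "decode_edge vs ij = {vs ! fst ij, vs ! snd ij}"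

definition graph_encoding ::
    "'v set \<Rightarrow> 'v set set \<Rightarrow> 'v list \<Rightarrow> (nat \<times> nat) list \<Rightarrow> bool" where
  "graph_encoding V E vs es \<longleftrightarrow>
     distinct vs \<and> set vs = V \<and>
     (\<forall>(i, j) \<in> set es. i < length vs \<and> j < length vs) \<and>
     distinct (map (decode_edge vs) es) \<and> decode_edge vs ` set es = E"

text \<open>Besides the two lengths the input holds the coordinates of the point of each vertex and the
  end vertices of each edge. The rest of the memory is initially zero.\<close>

definition array_of :: "nat list \<Rightarrow> nat \<Rightarrow> nat" where
  "array_of xs i = (if i < length xs then xs ! i else 0)"

definition input_state ::
    "('v \<Rightarrow> nat \<times> nat) \<Rightarrow> 'v list \<Rightarrow> (nat \<times> nat) list \<Rightarrow> state" where
  "input_state \<mu> vs es =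
     ((\<lambda>_. 0)(''n'' := length vs, ''m'' := length es),
      (\<lambda>_ _. 0)(''x'' := array_of (map (fst \<circ> \<mu>) vs),
                ''y'' := array_of (map (snd \<circ> \<mu>) vs),
                ''src'' := array_of (map fst es),
                ''dst'' := array_of (map snd es)))"

definition accepts :: "state \<Rightarrow> bool" where
  "accepts s \<longleftrightarrow> fst s ''ans'' \<noteq> 0"

text \<open>For the \<open>k\<close>-th edge the output says whether it has a bend and, if so, where.\<close>

definition output_chain ::
    "('v \<Rightarrow> nat \<times> nat) \<Rightarrow> 'v list \<Rightarrow> (nat \<times> nat) list \<Rightarrow> state \<Rightarrow> nat \<Rightarrow> point list" where
  "output_chain \<mu> vs es s k =
     [pt (\<mu> (vs ! fst (es ! k)))] @
     (if snd s ''bend'' k = 0 then [] else [pt (snd s ''bx'' k, snd s ''by'' k)]) @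
     [pt (\<mu> (vs ! snd (es ! k)))]"

definition output_drawing ::
    "('v \<Rightarrow> nat \<times> nat) \<Rightarrow> 'v list \<Rightarrow> (nat \<times> nat) list \<Rightarrow> state \<Rightarrow> 'v set \<Rightarrow> point list" where
  "output_drawing \<mu> vs es s e =
     output_chain \<mu> vs es s (THE k. k < length es \<and> decode_edge vs (es ! k) = e)"

end

theory Submission
  imports Defs
begin

text \<open>
  No two points share a row or a column, so every edge has exactly one bend and is one of the two
  L-shapes between its ends: vertical at one end, horizontal at the other. The row or column of a
  segment meets the point set only in the vertex that the segment starts from, so the only possible
  conflict is that two edges leave a common vertex in the same direction. For every edge this is a
  binary choice, and each pair of edges that compete for a direction gives a clause with two
  literals; as degrees are at most 4, there are \<open>O(n)\<close> clauses.

  The 2-satisfiability instance is solved by limited backtracking: for an undecided edge, the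
  consequences of its two choices are propagated in lockstep, and the propagation that first ends
  without a contradiction is committed. The set of committed literals is closed under implication,
  so by contraposition it never contradicts a later propagation. The time of a round is
  proportional to the number of literals that it commits, which makes the total time linear.
\<close>


section \<open>Total correctness with running time\<close>

text \<open>Two things shape the proof. The machine gets stuck on large values, whereas reasoning
  about loops is easier with unbounded words. Hence \<open>ok\<close> asserts a run for some word
  size. The polynomial bound is recovered once, at the end, from the running time: the program only
  adds 0, 1, \<open>n\<close> or \<open>m\<close>, so values grow linearly with time. The other
  point is the cost of abandoned work. In lockstep the losing propagation never makes more
  expansions than the winning one, so both can be charged to the literals that the winner commits.
  For this an expansion has to take constant time: every slot keeps a list of at most four users, a
  bound that comes from the degree. Starting a round has to be cheap as well: marks are stamps that
  increase from round to round, so nothing is ever cleared. The single round in which both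
  propagations fail commits nothing, but it ends the search, so a linear reserve pays for
  it.\<close>

definition ok :: "com \<Rightarrow> state \<Rightarrow> (nat \<Rightarrow> state \<Rightarrow> bool) \<Rightarrow> bool" where
  "ok c s Q \<longleftrightarrow> (\<exists>w t s'. exec w c s t s' \<and> Q t s')"

text \<open>A larger word size only relaxes the side conditions of the two storing rules. Runs found
  at different word sizes can thus be joined at the maximum.\<close>

lemma exec_mono: "exec w c s t s' \<Longrightarrow> w \<le> w' \<Longrightarrow> exec w' c s t s'"
  by (induction rule: exec.induct) (blast intro: exec.intros order_trans)+

lemma ok_weaken: "ok c s Q \<Longrightarrow> (\<And>t s'. Q t s' \<Longrightarrow> Q' t s') \<Longrightarrow> ok c s Q'"
  unfolding ok_def by blast

lemma ok_Seq: "ok c s (\<lambda>t s'. ok d s' (\<lambda>t'. Q (t + t'))) \<Longrightarrow> ok (Seq c d) s Q"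
proof -
  assume "ok c s (\<lambda>t s'. ok d s' (\<lambda>t'. Q (t + t')))"
  then obtain w t s' w' t' s'' where
    "exec w c s t s'" "exec w' d s' t' s''" "Q (t + t') s''"
    unfolding ok_def by blast
  then have "exec (max w w') (Seq c d) s (t + t') s''" "Q (t + t') s''"
    using exec_mono exec_Seq by (meson max.cobounded1 max.cobounded2)+
  then show ?thesis unfolding ok_def by blast
qed

lemma ok_Skip: "Q 1 s \<Longrightarrow> ok Skip s Q"
  unfolding ok_def using exec_Skip by blast

lemma ok_Cond:
  assumes "bval b s \<Longrightarrow> ok c s (\<lambda>t. Q (1 + bcost b + t))"
    and "\<not> bval b s \<Longrightarrow> ok d s (\<lambda>t. Q (1 + bcost b + t))"
  shows "ok (Cond b c d) s Q"
  using assms unfolding ok_def by (cases "bval b s") (blast intro: exec_CondT exec_CondF)+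

lemma ok_WhileF: "\<not> bval b s \<Longrightarrow> Q (1 + bcost b) s \<Longrightarrow> ok (While b c) s Q"
  unfolding ok_def using exec_WhileF by blast

lemma ok_WhileT:
  assumes "bval b s" "ok c s (\<lambda>t s'. ok (While b c) s' (\<lambda>t'. Q (1 + bcost b + t + t')))"
  shows "ok (While b c) s Q"
proof -
  obtain w t s' w' t' s'' where
    "exec w c s t s'" "exec w' (While b c) s' t' s''" "Q (1 + bcost b + t + t') s''"
    using assms(2) unfolding ok_def by blast
  then have "exec (max w w') (While b c) s (1 + bcost b + t + t') s''" "Q (1 + bcost b + t + t') s''"
    using exec_mono exec_WhileT[OF assms(1)] by (meson max.cobounded1 max.cobounded2)+
  then show ?thesis unfolding ok_def by blast
qed

text \<open>Each iteration costs at least one unit, so \<open>\<Phi>\<close> strictly decreases and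
  proves termination as well as the time bound. This form is for the main loop, whose rounds have no
  constant bound.\<close>

lemma ok_While_potential:
  fixes \<Phi> :: "state \<Rightarrow> nat"
  assumes "I s"
    and step: "\<And>s. I s \<Longrightarrow> bval b s \<Longrightarrow> ok c s (\<lambda>t s'. I s' \<and> 1 + bcost b + t + \<Phi> s' \<le> \<Phi> s)"
  shows "ok (While b c) s (\<lambda>t s'. I s' \<and> \<not> bval b s' \<and> t \<le> \<Phi> s + 1 + bcost b)"
  using assms(1)
proof (induction "\<Phi> s" arbitrary: s rule: less_induct)
  case less
  show ?case
  proof (cases "bval b s")
    case True
    show ?thesis
    proof (rule ok_WhileT[OF True], rule ok_weaken[OF step[OF less.prems True]])
      fix t s' assume a: "I s' \<and> 1 + bcost b + t + \<Phi> s' \<le> \<Phi> s"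
      show "ok (While b c) s' (\<lambda>t' s''. I s'' \<and> \<not> bval b s'' \<and>
              1 + bcost b + t + t' \<le> \<Phi> s + 1 + bcost b)"
        by (rule ok_weaken[OF less.hyps]) (use a in auto)
    qed
  qed (use less.prems in \<open>auto intro: ok_WhileF\<close>)
qed

text \<open>\<open>N\<close> only enforces termination; the time is stated with the number
  \<open>r' - r\<close> of iterations actually made. The lockstep loop depends on this, as its cost
  is charged to its own length and not to \<open>N\<close>.\<close>

lemma ok_While_count:
  assumes "I r s"
    and step: "\<And>r s. I r s \<Longrightarrow> bval b s \<Longrightarrow> r < N \<and> ok c s (\<lambda>t s'. t \<le> K \<and> I (Suc r) s')"
  shows "ok (While b c) s
    (\<lambda>t s'. \<exists>r'. r \<le> r' \<and> I r' s' \<and> \<not> bval b s' \<and> t \<le> (r' - r) * (K + 1 + bcost b) + 1 + bcost b)"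
  using assms(1)
proof (induction "N - r" arbitrary: r s rule: less_induct)
  case less
  show ?case
  proof (cases "bval b s")
    case True
    note st = step[OF less.prems True]
    show ?thesis
    proof (rule ok_WhileT[OF True], rule ok_weaken[OF conjunct2[OF st]])
      fix t s' assume a: "t \<le> K \<and> I (Suc r) s'"
      show "ok (While b c) s' (\<lambda>t' s''. \<exists>r'\<ge>r. I r' s'' \<and> \<not> bval b s'' \<and>
              1 + bcost b + t + t' \<le> (r' - r) * (K + 1 + bcost b) + 1 + bcost b)"
      proof (rule ok_weaken[OF less.hyps[of "Suc r"]], goal_cases)
        case (3 t' s'')
        then obtain r' where r': "r' \<ge> Suc r" "I r' s''" "\<not> bval b s''"
          "t' \<le> (r' - Suc r) * (K + 1 + bcost b) + 1 + bcost b" by blast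
        then have "r' - r = Suc (r' - Suc r)" by simp
        with r' a show ?case by (intro exI[of _ r']) auto
      qed (use a st in auto)
    qed
  qed (rule ok_WhileF, use less.prems in auto)
qed

primrec loop_free :: "com \<Rightarrow> bool" where
  "loop_free Skip \<longleftrightarrow> True"
| "loop_free (Assign x e) \<longleftrightarrow> True"
| "loop_free (Store a i e) \<longleftrightarrow> True"
| "loop_free (Seq c d) \<longleftrightarrow> loop_free c \<and> loop_free d"
| "loop_free (Cond b c d) \<longleftrightarrow> loop_free c \<and> loop_free d"
| "loop_free (While b c) \<longleftrightarrow> False"

text \<open>The clauses for \<open>While\<close> in \<open>eff\<close> and \<open>tm\<close> are
  dummy values, since both are meant for \<open>loop_free\<close> commands. \<open>tm\<close>
  charges both branches of a conditional, which makes it a function of the command alone.\<close>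

primrec eff :: "com \<Rightarrow> state \<Rightarrow> state" where
  "eff Skip s = s"
| "eff (Assign x e) s = ((fst s)(x := aval e s), snd s)"
| "eff (Store a i e) s = (fst s, (snd s)(a := (snd s a)(aval i s := aval e s)))"
| "eff (Seq c d) s = eff d (eff c s)"
| "eff (Cond b c d) s = (if bval b s then eff c s else eff d s)"
| "eff (While b c) s = s"

primrec tm :: "com \<Rightarrow> nat" where
  "tm Skip = 1"
| "tm (Assign x e) = 1 + acost e"
| "tm (Store a i e) = 1 + acost i + acost e"
| "tm (Seq c d) = tm c + tm d"
| "tm (Cond b c d) = 1 + bcost b + tm c + tm d"
| "tm (While b c) = 0"

lemma ok_loop_free: "loop_free c \<Longrightarrow> ok c s (\<lambda>t s'. t \<le> tm c \<and> s' = eff c s)"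
proof (induction c arbitrary: s)
  case Skip
  then show ?case by (auto intro: ok_Skip)
next
  case (Assign x e)
  then show ?case unfolding ok_def using exec_Assign[of e s "aval e s" x] by fastforce
next
  case (Store a i e)
  then show ?case unfolding ok_def using exec_Store[of e s "aval e s" a i] by fastforce
next
  case (Seq c d)
  show ?case
    by (rule ok_Seq, rule ok_weaken[OF Seq.IH(1)], use Seq.prems in simp,
        rule ok_weaken[OF Seq.IH(2)]) (use Seq.prems in auto)
next
  case (Cond b c d)
  show ?case
    by (rule ok_Cond; rule ok_weaken, rule Cond.IH) (use Cond.prems in auto)
qed simp

text \<open>The closing \<open>Skip\<close> costs one unit; it is the origin of the summand 1 in
  bounds such as \<open>expand_time\<close>.\<close>

definition block :: "com list \<Rightarrow> com" where
  "block cs = foldr Seq cs Skip"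

lemma block_simps [simp]:
  "loop_free (block cs) \<longleftrightarrow> (\<forall>c\<in>set cs. loop_free c)"
  "eff (block []) s = s"
  "eff (block (c # cs)) s = eff (block cs) (eff c s)"
  by (induction cs) (auto simp: block_def)

lemma ok_block_Nil: "Q 1 s \<Longrightarrow> ok (block []) s Q"
  by (simp add: block_def ok_Skip)

lemma ok_block_Cons:
  "ok c s (\<lambda>t s'. ok (block cs) s' (\<lambda>t'. Q (t + t'))) \<Longrightarrow> ok (block (c # cs)) s Q"
  by (simp add: block_def ok_Seq)


section \<open>Word size\<close>

text \<open>In a tame program no more than constants and the registers in \<open>P\<close>, which are never
  assigned, is added to a value. Its values thus grow linearly with the running time, so a bound
  on the time implies a bound on the words.\<close>

primrec summand :: "string set \<Rightarrow> aexp \<Rightarrow> bool" where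
  "summand P (Const k) \<longleftrightarrow> k \<le> 1"
| "summand P (Var x) \<longleftrightarrow> x \<in> P"
| "summand P (Read a i) \<longleftrightarrow> False"
| "summand P (Add e f) \<longleftrightarrow> False"
| "summand P (Sub e f) \<longleftrightarrow> False"

primrec tame_exp :: "string set \<Rightarrow> aexp \<Rightarrow> bool" where
  "tame_exp P (Const k) \<longleftrightarrow> k \<le> 1"
| "tame_exp P (Var x) \<longleftrightarrow> True"
| "tame_exp P (Read a i) \<longleftrightarrow> True"
| "tame_exp P (Add e f) \<longleftrightarrow> tame_exp P e \<and> summand P f"
| "tame_exp P (Sub e f) \<longleftrightarrow> tame_exp P e"

primrec tame :: "string set \<Rightarrow> com \<Rightarrow> bool" where
  "tame P Skip \<longleftrightarrow> True"
| "tame P (Assign x e) \<longleftrightarrow> x \<notin> P \<and> tame_exp P e"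
| "tame P (Store a i e) \<longleftrightarrow> tame_exp P e"
| "tame P (Seq c d) \<longleftrightarrow> tame P c \<and> tame P d"
| "tame P (Cond b c d) \<longleftrightarrow> tame P c \<and> tame P d"
| "tame P (While b c) \<longleftrightarrow> tame P c"

lemma tame_block [simp]: "tame P (block cs) \<longleftrightarrow> (\<forall>c\<in>set cs. tame P c)"
  by (induction cs) (auto simp: block_def)

definition values_le :: "nat \<Rightarrow> state \<Rightarrow> bool" where
  "values_le B s \<longleftrightarrow> (\<forall>x. fst s x \<le> B) \<and> (\<forall>a i. snd s a i \<le> B)"

lemma values_le_mono: "values_le B s \<Longrightarrow> B \<le> C \<Longrightarrow> values_le C s"
  unfolding values_le_def by (meson order_trans)

text \<open>A summand is worth at most \<open>M\<close>, and the cost of the \<open>Add\<close>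
  around it pays for it. A truncated subtraction cannot exceed its left operand.\<close>

lemma aval_tame:
  assumes "values_le B s" "\<forall>x\<in>P. fst s x \<le> M" "1 \<le> M" "tame_exp P e"
  shows "aval e s \<le> B + M * acost e"
  using assms(4)
proof (induction e)
  case (Add e f)
  have "aval f s \<le> M"
    using Add.prems assms(2,3) by (cases f) auto
  moreover have "M \<le> M * acost f" using assms(3) by (cases f) auto
  ultimately show ?case using Add by (simp add: distrib_left)
next
  case (Sub e f)
  then have "aval e s \<le> B + M * acost e" by simp
  then show ?case by (simp add: distrib_left)
next
  case (Var x) then show ?case using assms(1) by (simp add: values_le_def trans_le_add1)
next
  case (Read a i) then show ?case using assms(1) by (simp add: values_le_def trans_le_add1)
qed (use assms(3) in auto)

text \<open>Stored values rise by at most \<open>M\<close> per time unit. A run of length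
  \<open>t\<close>, found with some unknown word size \<open>w'\<close>, therefore never stores more
  than \<open>B + M * t\<close>, and it is also a run with words up to \<open>w\<close>.\<close>

lemma exec_tame:
  assumes "exec w' c s t s'" "tame P c" "values_le B s" "\<forall>x\<in>P. fst s x \<le> M" "1 \<le> M"
    "B + M * t \<le> w"
  shows "exec w c s t s' \<and> values_le (B + M * t) s' \<and> (\<forall>x\<in>P. fst s' x \<le> M)"
  using assms
proof (induction arbitrary: B rule: exec.induct)
  case (exec_Skip s)
  from exec_Skip.prems show ?case
    by (intro conjI exec.exec_Skip) (auto elim!: values_le_mono)
next
  case (exec_Assign e s x)
  have v: "aval e s \<le> B + M * acost e"
    by (rule aval_tame) (use exec_Assign.prems in auto)
  then have v': "aval e s \<le> B + M * (1 + acost e)" by simp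
  have "values_le (B + M * (1 + acost e)) s"
    by (rule values_le_mono[OF exec_Assign.prems(2)]) simp
  then have "values_le (B + M * (1 + acost e)) ((fst s)(x := aval e s), snd s)"
    using v' by (simp add: values_le_def)
  with v' exec_Assign.prems show ?case by (intro conjI exec.exec_Assign) auto
next
  case (exec_Store e s a i)
  have v: "aval e s \<le> B + M * acost e"
    by (rule aval_tame) (use exec_Store.prems in auto)
  then have v': "aval e s \<le> B + M * (1 + acost i + acost e)" by (simp add: distrib_left)
  have "values_le (B + M * (1 + acost i + acost e)) s"
    by (rule values_le_mono[OF exec_Store.prems(2)]) simp
  then have "values_le (B + M * (1 + acost i + acost e))
      (fst s, (snd s)(a := (snd s a)(aval i s := aval e s)))"
    using v' by (simp add: values_le_def)
  with v' exec_Store.prems show ?case by (intro conjI exec.exec_Store) auto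
next
  case (exec_Seq c s t s' d t' s2)
  have "exec w c s t s' \<and> values_le (B + M * t) s' \<and> (\<forall>x\<in>P. fst s' x \<le> M)"
    by (rule exec_Seq.IH(1)) (use exec_Seq.prems in \<open>auto simp: distrib_left\<close>)
  moreover from this have
    "exec w d s' t' s2 \<and> values_le (B + M * t + M * t') s2 \<and> (\<forall>x\<in>P. fst s2 x \<le> M)"
    by (intro exec_Seq.IH(2)) (use exec_Seq.prems in \<open>auto simp: distrib_left\<close>)
  ultimately show ?case
    by (intro conjI exec.exec_Seq[of w c s t s']) (auto simp: distrib_left add.assoc)
next
  case (exec_CondT b s c t s' d)
  have "exec w c s t s' \<and> values_le (B + M * t) s' \<and> (\<forall>x\<in>P. fst s' x \<le> M)"
    by (rule exec_CondT.IH) (use exec_CondT.prems in \<open>auto simp: distrib_left\<close>)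
  with exec_CondT.hyps(1) show ?case
    by (intro conjI exec.exec_CondT) (auto elim!: values_le_mono simp: distrib_left)
next
  case (exec_CondF b s d t s' c)
  have "exec w d s t s' \<and> values_le (B + M * t) s' \<and> (\<forall>x\<in>P. fst s' x \<le> M)"
    by (rule exec_CondF.IH) (use exec_CondF.prems in \<open>auto simp: distrib_left\<close>)
  with exec_CondF.hyps(1) show ?case
    by (intro conjI exec.exec_CondF) (auto elim!: values_le_mono simp: distrib_left)
next
  case (exec_WhileF b s c)
  then show ?case by (intro conjI exec.exec_WhileF) (auto elim!: values_le_mono)
next
  case (exec_WhileT b s c t s' t' s2)
  have "exec w c s t s' \<and> values_le (B + M * t) s' \<and> (\<forall>x\<in>P. fst s' x \<le> M)"
    by (rule exec_WhileT.IH(1)) (use exec_WhileT.prems in \<open>auto simp: distrib_left\<close>)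
  moreover from this have
    "exec w (While b c) s' t' s2 \<and> values_le (B + M * t + M * t') s2 \<and> (\<forall>x\<in>P. fst s2 x \<le> M)"
    by (intro exec_WhileT.IH(2)) (use exec_WhileT.prems in \<open>auto simp: distrib_left\<close>)
  ultimately show ?case using exec_WhileT.hyps(1)
    by (intro conjI exec.exec_WhileT[of b s w c t s']) (auto elim!: values_le_mono simp: distrib_left)
qed

section \<open>2-satisfiability by limited backtracking\<close>

text \<open>\<open>cf a b\<close> is the clause that forbids \<open>a\<close> and \<open>b\<close>
  together. It acts as the implication from \<open>a\<close> to \<open>ng b\<close> and, by
  symmetry, from \<open>b\<close> to \<open>ng a\<close>.\<close>

locale two_sat =
  fixes N :: nat and ng :: "nat \<Rightarrow> nat" and cf :: "nat \<Rightarrow> nat \<Rightarrow> bool"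
  assumes ng_less: "l < N \<Longrightarrow> ng l < N"
    and ng_ng: "l < N \<Longrightarrow> ng (ng l) = l"
    and ng_neq: "l < N \<Longrightarrow> ng l \<noteq> l"
    and cf_sym: "cf a b \<Longrightarrow> cf b a"
    and cf_less: "cf a b \<Longrightarrow> b < N"
begin

definition solves :: "nat set \<Rightarrow> bool" where
  "solves X \<longleftrightarrow> X \<subseteq> {..<N} \<and> (\<forall>l<N. ng l \<in> X \<longleftrightarrow> l \<notin> X) \<and> (\<forall>a\<in>X. \<forall>b\<in>X. \<not> cf a b)"

text \<open>Two sets, because in the middle of a propagation only the expanded entries
  \<open>A\<close> have all their consequences among the known literals \<open>Y\<close>.\<close>

definition closed_under :: "nat set \<Rightarrow> nat set \<Rightarrow> bool" where
  "closed_under Y A \<longleftrightarrow> (\<forall>a\<in>A. \<forall>b. cf a b \<longrightarrow> ng b \<in> Y)"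

definition consistent :: "nat set \<Rightarrow> bool" where
  "consistent Y \<longleftrightarrow> (\<forall>a\<in>Y. ng a \<notin> Y)"

text \<open>Reachability from \<open>l\<close> in the implication graph.\<close>

inductive_set implied :: "nat \<Rightarrow> nat set" for l where
  base: "l \<in> implied l"
| step: "a \<in> implied l \<Longrightarrow> cf a b \<Longrightarrow> ng b \<in> implied l"

lemma implied_solves:
  assumes "solves X" "l \<in> X" "a \<in> implied l"
  shows "a \<in> X"
  using assms(3)
proof induction
  case (step a b)
  with assms(1) have "b \<notin> X" "b < N" using cf_less unfolding solves_def by blast+
  with assms(1) show ?case unfolding solves_def by blast
qed (rule assms(2))

text \<open>A solution contains \<open>l\<close> or \<open>ng l\<close>, and with it everything
  implied by that literal; but it contains no complementary pair.\<close>

lemma not_solvable: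
  assumes "l < N" "\<not> consistent (implied l)" "\<not> consistent (implied (ng l))"
  shows "\<not> solves X"
proof
  assume X: "solves X"
  have "consistent (implied k)" if "k \<in> X" for k
    unfolding consistent_def
  proof
    fix a assume "a \<in> implied k"
    then have "a \<in> X" by (rule implied_solves[OF X that])
    then have "ng a \<notin> X" using X unfolding solves_def by blast
    then show "ng a \<notin> implied k" using implied_solves[OF X that] by blast
  qed
  with assms X show False unfolding solves_def by blast
qed

text \<open>A conflict \<open>cf a b\<close> inside \<open>Y\<close> would force \<open>ng b\<close>
  into \<open>Y\<close> beside \<open>b\<close>, so closure and consistency together already rule
  out every conflict.\<close>

lemma solves_total:
  assumes "Y \<subseteq> {..<N}" "closed_under Y Y" "consistent Y" "\<And>l. l < N \<Longrightarrow> l \<in> Y \<or> ng l \<in> Y"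
  shows "solves Y"
proof -
  have "ng l \<in> Y \<longleftrightarrow> l \<notin> Y" if "l < N" for l
    using assms(3,4) that unfolding consistent_def by blast
  moreover have "\<not> cf a b" if "a \<in> Y" "b \<in> Y" for a b
    using assms(2,3) that unfolding consistent_def closed_under_def by blast
  ultimately show ?thesis using assms(1) unfolding solves_def by blast
qed

text \<open>The state of a propagation from \<open>l\<^sub>0\<close>: the first \<open>t\<close> entries of the queue \<open>q\<close> are the
  literals found so far, \<open>M\<close> stamps them with \<open>p\<close>, and \<open>c\<close> flags a contradiction.\<close>

definition propagation ::
    "nat \<Rightarrow> nat set \<Rightarrow> nat \<Rightarrow> (nat \<Rightarrow> nat) \<Rightarrow> (nat \<Rightarrow> nat) \<Rightarrow> nat \<Rightarrow> nat \<Rightarrow> bool" where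
  "propagation l\<^sub>0 Y p M q t c \<longleftrightarrow>
     (\<forall>i<t. q i < N) \<and> inj_on q {..<t} \<and> (\<forall>a. M a = p \<longleftrightarrow> a \<in> q ` {..<t}) \<and> (\<forall>a. M a \<le> p) \<and>
     l\<^sub>0 \<in> q ` {..<t} \<and> q ` {..<t} \<subseteq> implied l\<^sub>0 \<and>
     (\<forall>a \<in> q ` {..<t}. a \<notin> Y \<and> ng a \<notin> Y) \<and>
     (c = 0 \<longrightarrow> consistent (q ` {..<t})) \<and> (c \<noteq> 0 \<longrightarrow> \<not> consistent (implied l\<^sub>0))"

lemma propagation_start:
  assumes "l < N" "l \<notin> Y" "ng l \<notin> Y" "q 0 = l" "\<And>a. M a = p \<longleftrightarrow> a = l" "\<And>a. M a \<le> p"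
  shows "propagation l Y p M q (Suc 0) 0"
proof -
  have "q ` {..<Suc 0} = {l}" using assms(4) by (simp add: lessThan_Suc)
  then show ?thesis
    using assms ng_neq[of l] implied.base[of l]
    unfolding propagation_def consistent_def by (simp add: lessThan_Suc)
qed

text \<open>The queue holds distinct literals. This limits the number of lockstep rounds.\<close>

lemma propagation_length:
  assumes "propagation l\<^sub>0 Y p M q t c"
  shows "t \<le> N"
proof -
  have "q ` {..<t} \<subseteq> {..<N}" "card (q ` {..<t}) = t"
    using assms by (auto simp: propagation_def card_image)
  then show ?thesis by (metis card_lessThan card_mono finite_lessThan)
qed

text \<open>The only literal that can clash with a new entry \<open>ng b\<close> is
  \<open>b\<close>, so it suffices to look at the stamp of \<open>b\<close>: whichever member of a
  pair is pushed second raises the flag.\<close>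

lemma propagation_push:
  assumes P: "propagation l\<^sub>0 Y p M q t c" and Y: "closed_under Y Y"
    and l: "l \<in> q ` {..<t}" "cf l b" and new: "ng b \<notin> Y" "M (ng b) \<noteq> p"
  shows "propagation l\<^sub>0 Y p (M(ng b := p)) (q(t := ng b)) (Suc t) (if M b = p then 1 else c)"
proof -
  let ?Q = "q ` {..<t}"
  have b: "b < N" using cf_less l by blast
  have Q: "(q(t := ng b)) ` {..<Suc t} = insert (ng b) ?Q"
    by (auto simp: lessThan_Suc)
  have notin: "ng b \<notin> ?Q" using P new unfolding propagation_def by blast
  have imp: "ng b \<in> implied l\<^sub>0"
    using P l implied.step unfolding propagation_def by blast
  \<comment> \<open>The contraposition: if \<open>b\<close> were committed, closure of
    \<open>Y\<close> would have committed \<open>ng l\<close> too, but no queue entry has its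
    negation in \<open>Y\<close>. So the new entry keeps this invariant.\<close>
  have "b \<notin> Y"
  proof
    assume "b \<in> Y"
    then have "ng l \<in> Y" using Y cf_sym[OF l(2)] unfolding closed_under_def by blast
    with P l(1) show False unfolding propagation_def by blast
  qed
  have "inj_on (q(t := ng b)) {..<t}"
    using P unfolding propagation_def inj_on_def by simp
  moreover have "(q(t := ng b)) ` {..<t} = ?Q" by auto
  ultimately have inj: "inj_on (q(t := ng b)) {..<Suc t}"
    using notin unfolding lessThan_Suc by simp
  have con: "consistent (insert (ng b) ?Q)" if "M b \<noteq> p" "c = 0"
  proof -
    have "b \<notin> ?Q" "consistent ?Q" using that P unfolding propagation_def by auto
    moreover have "ng a \<noteq> ng b" if "a \<in> ?Q" for a
    proof
      assume "ng a = ng b"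
      moreover have "a < N" using that P unfolding propagation_def by auto
      ultimately have "a = b" using ng_ng b by metis
      with that \<open>b \<notin> ?Q\<close> show False by simp
    qed
    moreover have "ng (ng b) \<noteq> ng b" using ng_neq ng_less b by blast
    ultimately show ?thesis using ng_ng[OF b] unfolding consistent_def by auto
  qed
  have incon: "\<not> consistent (implied l\<^sub>0)" if "M b = p"
  proof -
    have "b \<in> implied l\<^sub>0" using that P unfolding propagation_def by blast
    with imp show ?thesis unfolding consistent_def by blast
  qed
  show ?thesis unfolding propagation_def Q
  proof (intro conjI)
    show "\<forall>i<Suc t. (q(t := ng b)) i < N"
      using P ng_less[OF b] unfolding propagation_def by (simp add: less_Suc_eq)
    show "\<forall>a. ((M(ng b := p)) a = p) = (a \<in> insert (ng b) ?Q)"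
      "\<forall>a. (M(ng b := p)) a \<le> p"
      using P unfolding propagation_def by simp_all
    show "l\<^sub>0 \<in> insert (ng b) ?Q" "insert (ng b) ?Q \<subseteq> implied l\<^sub>0"
      using P imp unfolding propagation_def by blast+
    show "\<forall>a\<in>insert (ng b) ?Q. a \<notin> Y \<and> ng a \<notin> Y"
      using P new(1) \<open>b \<notin> Y\<close> ng_ng[OF b] unfolding propagation_def by simp
    show "(if M b = p then 1 else c) = 0 \<longrightarrow> consistent (insert (ng b) ?Q)"
      using con by simp
    show "(if M b = p then 1 else c) \<noteq> 0 \<longrightarrow> \<not> consistent (implied l\<^sub>0)"
      using P incon unfolding propagation_def by simp
  qed (rule inj)
qed

text \<open>A visit to the entry \<open>z\<close> of a conflict list of \<open>l\<close>; entries are shifted by one,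
  and \<open>0\<close> is an empty entry.\<close>

fun visited :: "nat set \<Rightarrow> nat \<Rightarrow> nat \<Rightarrow> nat \<Rightarrow> (nat \<Rightarrow> nat) \<times> (nat \<Rightarrow> nat) \<times> nat \<times> nat \<Rightarrow>
    (nat \<Rightarrow> nat) \<times> (nat \<Rightarrow> nat) \<times> nat \<times> nat" where
  "visited Y p l z (M, q, t, c) =
     (if 0 < z \<and> z - 1 \<noteq> l \<and> ng (z - 1) \<notin> Y \<and> M (ng (z - 1)) \<noteq> p
      then (M(ng (z - 1) := p), q(t := ng (z - 1)), Suc t, if M (z - 1) = p then 1 else c)
      else (M, q, t, c))"

text \<open>The unchanged prefix keeps earlier expansions valid while the queue grows. The last
  clause is what makes \<open>l\<close> count as expanded once \<open>zs\<close> lists all its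
  conflicts.\<close>

lemma propagation_visited:
  assumes "propagation l\<^sub>0 Y p M q t c" "closed_under Y Y" "l \<in> q ` {..<t}"
    "\<And>z. z \<in> set zs \<Longrightarrow> 0 < z \<Longrightarrow> z - 1 \<noteq> l \<Longrightarrow> cf l (z - 1)"
    "fold (visited Y p l) zs (M, q, t, c) = (M', q', t', c')"
  shows "propagation l\<^sub>0 Y p M' q' t' c' \<and> t \<le> t' \<and> (\<forall>i<t. q' i = q i) \<and>
    (\<forall>z\<in>set zs. 0 < z \<longrightarrow> z - 1 \<noteq> l \<longrightarrow> ng (z - 1) \<in> Y \<union> q' ` {..<t'})"
  using assms
proof (induction zs arbitrary: M q t c)
  case Nil
  then show ?case by simp
next
  case (Cons z zs)
  obtain M1 q1 t1 c1 where v: "visited Y p l z (M, q, t, c) = (M1, q1, t1, c1)"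
    using prod_cases4 by blast
  have one: "propagation l\<^sub>0 Y p M1 q1 t1 c1 \<and> t \<le> t1 \<and> (\<forall>i<t. q1 i = q i) \<and>
      (0 < z \<longrightarrow> z - 1 \<noteq> l \<longrightarrow> ng (z - 1) \<in> Y \<union> q1 ` {..<t1})"
  proof (cases "0 < z \<and> z - 1 \<noteq> l \<and> ng (z - 1) \<notin> Y \<and> M (ng (z - 1)) \<noteq> p")
    case True
    then have "cf l (z - 1)" using Cons.prems(4)[of z] by simp
    from propagation_push[OF Cons.prems(1-3) this] True v
    show ?thesis by (auto simp: lessThan_Suc)
  next
    case False
    with v have eq: "M1 = M" "q1 = q" "t1 = t" "c1 = c"
      unfolding visited.simps if_not_P[OF False] by simp_all
    show ?thesis using False Cons.prems(1) unfolding eq by (auto simp: propagation_def)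
  qed
  have "l \<in> q1 ` {..<t1}"
  proof -
    obtain i where "i < t" "l = q i" using Cons.prems(3) by auto
    then have "i < t1" "l = q1 i" using one by auto
    then show ?thesis by blast
  qed
  moreover have "fold (visited Y p l) zs (M1, q1, t1, c1) = (M', q', t', c')"
    using Cons.prems(5) v by simp
  ultimately have rest: "propagation l\<^sub>0 Y p M' q' t' c' \<and> t1 \<le> t' \<and> (\<forall>i<t1. q' i = q1 i) \<and>
    (\<forall>z\<in>set zs. 0 < z \<longrightarrow> z - 1 \<noteq> l \<longrightarrow> ng (z - 1) \<in> Y \<union> q' ` {..<t'})"
    using Cons.IH[of M1 q1 t1 c1] one Cons.prems(2,4) by simp
  have "q1 ` {..<t1} \<subseteq> q' ` {..<t'}"
  proof
    fix a assume "a \<in> q1 ` {..<t1}"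
    then obtain i where "i < t1" "a = q1 i" by auto
    then have "i < t'" "a = q' i" using rest by auto
    then show "a \<in> q' ` {..<t'}" by blast
  qed
  with one rest show ?case by auto
qed

text \<open>Queue entries and their negations avoid \<open>Y\<close>, so no complementary pair lies
  across the two sets. The cardinality is the gain to which the time of the round is
  charged.\<close>

lemma commit_closed:
  assumes "propagation l\<^sub>0 Y p M q t 0" "closed_under (Y \<union> q ` {..<t}) (q ` {..<t})"
    "closed_under Y Y" "consistent Y" "Y \<subseteq> {..<N}"
  shows "closed_under (Y \<union> q ` {..<t}) (Y \<union> q ` {..<t})" "consistent (Y \<union> q ` {..<t})"
    "Y \<union> q ` {..<t} \<subseteq> {..<N}" "card (Y \<union> q ` {..<t}) = card Y + t"
proof -
  show "closed_under (Y \<union> q ` {..<t}) (Y \<union> q ` {..<t})"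
    using assms(2,3) unfolding closed_under_def by blast
  have "ng a \<notin> q ` {..<t}" if "a \<in> Y" for a
  proof
    assume "ng a \<in> q ` {..<t}"
    then have "ng (ng a) \<notin> Y" using assms(1) unfolding propagation_def by blast
    with that assms(5) ng_ng show False by auto
  qed
  then show "consistent (Y \<union> q ` {..<t})"
    using assms(1,4) unfolding consistent_def propagation_def by blast
  show "Y \<union> q ` {..<t} \<subseteq> {..<N}"
    using assms(1,5) unfolding propagation_def by blast
  have "Y \<inter> q ` {..<t} = {}" "card (q ` {..<t}) = t"
    using assms(1) unfolding propagation_def by (auto simp: card_image)
  moreover have "finite Y" using assms(5) finite_subset by blast
  ultimately show "card (Y \<union> q ` {..<t}) = card Y + t" by (simp add: card_Un_disjoint)
qed

end

section \<open>The program\<close>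

text \<open>Literals are the numbers below \<open>m + m\<close>: the edge \<open>i\<close> is drawn either by the literal \<open>i\<close> or by
  \<open>i + m\<close>. The literal \<open>l\<close> leaves its end vertex \<open>va[l]\<close> vertically and \<open>ho[l]\<close> horizontally.
  The slots, that is the four directions at a vertex \<open>u\<close>, are \<open>u\<close> (up), \<open>u + n\<close> (down),
  \<open>u + 2 n\<close> (right), \<open>u + 3 n\<close> (left); \<open>A\<close> and \<open>B\<close> hold the slots of a literal. The arrays
  \<open>O0, \<dots>, O3\<close> hold the literals that use a slot, shifted by one.\<close>

definition set_ends :: com where
  "set_ends = block
    [Store ''va'' (Var ''i'') (Read ''src'' (Var ''i'')),
     Store ''va'' (Add (Var ''i'') (Var ''m'')) (Read ''dst'' (Var ''i'')),
     Store ''ho'' (Var ''i'') (Read ''dst'' (Var ''i'')),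
     Store ''ho'' (Add (Var ''i'') (Var ''m'')) (Read ''src'' (Var ''i'')),
     Store ''g'' (Var ''i'') (Add (Var ''i'') (Var ''m'')),
     Store ''g'' (Add (Var ''i'') (Var ''m'')) (Var ''i''),
     Assign ''i'' (Add (Var ''i'') (Const 1))]"

text \<open>A shift register with four places: the newest literal goes to the front and the content
  of \<open>O3\<close> is dropped. Nothing is lost, as a slot has at most four users
  (\<open>length_users\<close>). Because entries are shifted by one, zeroed memory reads as empty
  lists.\<close>

definition insert_slot :: com where
  "insert_slot = block
    [Store ''O3'' (Var ''s'') (Read ''O2'' (Var ''s'')),
     Store ''O2'' (Var ''s'') (Read ''O1'' (Var ''s'')),
     Store ''O1'' (Var ''s'') (Read ''O0'' (Var ''s'')),
     Store ''O0'' (Var ''s'') (Add (Var ''i'') (Const 1))]"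

definition set_slots :: com where
  "set_slots = block
    [Cond (Less (Read ''y'' (Read ''va'' (Var ''i''))) (Read ''y'' (Read ''ho'' (Var ''i''))))
       (Assign ''s'' (Read ''va'' (Var ''i'')))
       (Assign ''s'' (Add (Read ''va'' (Var ''i'')) (Var ''n''))),
     Store ''A'' (Var ''i'') (Var ''s''),
     insert_slot,
     Cond (Less (Read ''x'' (Read ''ho'' (Var ''i''))) (Read ''x'' (Read ''va'' (Var ''i''))))
       (Assign ''s'' (Add (Add (Read ''ho'' (Var ''i'')) (Var ''n'')) (Var ''n'')))
       (Assign ''s'' (Add (Add (Add (Read ''ho'' (Var ''i'')) (Var ''n'')) (Var ''n'')) (Var ''n''))),
     Store ''B'' (Var ''i'') (Var ''s''),
     insert_slot,
     Assign ''i'' (Add (Var ''i'') (Const 1))]"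

text \<open>The two propagations are told apart by a suffix \<open>k\<close> of the names that they use.\<close>

definition visit :: "string \<Rightarrow> string \<Rightarrow> string \<Rightarrow> com" where
  "visit k A U = block
    [Assign ''z'' (Read U (Read A (Var ''l''))),
     Cond (Conj (Less (Const 0) (Var ''z'')) (Neg (Equal (Sub (Var ''z'') (Const 1)) (Var ''l''))))
       (block
         [Assign ''a'' (Read ''g'' (Sub (Var ''z'') (Const 1))),
          Cond (Conj (Equal (Read ''v'' (Var ''a'')) (Const 0))
                 (Neg (Equal (Read (CHR ''M'' # k) (Var ''a'')) (Var ''p''))))
            (block
              [Cond (Equal (Read (CHR ''M'' # k) (Sub (Var ''z'') (Const 1))) (Var ''p''))
                 (Assign (CHR ''c'' # k) (Const 1)) Skip,
               Store (CHR ''M'' # k) (Var ''a'') (Var ''p''),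
               Store (CHR ''q'' # k) (Var (CHR ''t'' # k)) (Var ''a''),
               Assign (CHR ''t'' # k) (Add (Var (CHR ''t'' # k)) (Const 1))])
            Skip])
       Skip]"

definition conflict_arrays :: "(string \<times> string) list" where
  "conflict_arrays = List.product [''A'', ''B''] [''O0'', ''O1'', ''O2'', ''O3'']"

text \<open>The unit of the lockstep. A contradicted propagation is left as it is, so that its rival
  can go on alone.\<close>

definition expand :: "string \<Rightarrow> com" where
  "expand k = Cond (Equal (Var (CHR ''c'' # k)) (Const 0))
    (block
      [Assign ''l'' (Read (CHR ''q'' # k) (Var (CHR ''h'' # k))),
       Assign (CHR ''h'' # k) (Add (Var (CHR ''h'' # k)) (Const 1)),
       block (map (\<lambda>(A, U). visit k A U) conflict_arrays)])
    Skip"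

definition start :: "string \<Rightarrow> aexp \<Rightarrow> com" where
  "start k e = block
    [Assign (CHR ''h'' # k) (Const 0),
     Assign (CHR ''t'' # k) (Const 1),
     Assign (CHR ''c'' # k) (Const 0),
     Store (CHR ''q'' # k) (Const 0) e,
     Store (CHR ''M'' # k) e (Var ''p'')]"

definition won :: "string \<Rightarrow> bexp" where
  "won k = Conj (Equal (Var (CHR ''c'' # k)) (Const 0))
    (Equal (Var (CHR ''h'' # k)) (Var (CHR ''t'' # k)))"

definition undecided :: bexp where
  "undecided = Conj (Conj (Neg (won ''1'')) (Neg (won ''2'')))
    (Neg (Conj (Neg (Equal (Var ''c1'') (Const 0))) (Neg (Equal (Var ''c2'') (Const 0)))))"

definition commit_one :: "string \<Rightarrow> com" where
  "commit_one k = block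
    [Store ''v'' (Read (CHR ''q'' # k) (Var ''j'')) (Const 1),
     Assign ''j'' (Add (Var ''j'') (Const 1))]"

definition commit :: "string \<Rightarrow> com" where
  "commit k = block
    [Assign ''j'' (Const 0), While (Less (Var ''j'') (Var (CHR ''t'' # k))) (commit_one k)]"

text \<open>The stamp \<open>i + 1\<close> is larger than the stamps of all earlier rounds, so the
  mark arrays need no clearing.\<close>

definition start_both :: com where
  "start_both = block
    [Assign ''p'' (Add (Var ''i'') (Const 1)),
     start ''1'' (Var ''i''),
     start ''2'' (Add (Var ''i'') (Var ''m''))]"

definition try_both :: com where
  "try_both = block
    [start_both,
     While undecided (block [expand ''1'', expand ''2'']),
     Cond (won ''1'') (commit ''1'') (Cond (won ''2'') (commit ''2'') (Assign ''ok'' (Const 0)))]"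

definition decide_edge :: com where
  "decide_edge = block
    [Cond (Conj (Equal (Read ''v'' (Var ''i'')) (Const 0))
             (Equal (Read ''v'' (Add (Var ''i'') (Var ''m''))) (Const 0)))
       try_both Skip,
     Assign ''i'' (Add (Var ''i'') (Const 1))]"

text \<open>This also runs after a failed search. The bends are then meaningless, but the drawing is
  read only if the program accepts.\<close>

definition set_bend :: com where
  "set_bend = block
    [Cond (Equal (Read ''v'' (Var ''i'')) (Const 0))
       (Assign ''l'' (Add (Var ''i'') (Var ''m''))) (Assign ''l'' (Var ''i'')),
     Store ''bend'' (Var ''i'') (Const 1),
     Store ''bx'' (Var ''i'') (Read ''x'' (Read ''va'' (Var ''l''))),
     Store ''by'' (Var ''i'') (Read ''y'' (Read ''ho'' (Var ''l''))),
     Assign ''i'' (Add (Var ''i'') (Const 1))]"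

definition program :: com where
  "program = block
    [While (Less (Var ''i'') (Var ''m'')) set_ends,
     Assign ''i'' (Const 0),
     While (Less (Var ''i'') (Add (Var ''m'') (Var ''m''))) set_slots,
     block [Assign ''i'' (Const 0), Assign ''ok'' (Const 1)],
     While (Conj (Less (Var ''i'') (Var ''m'')) (Equal (Var ''ok'') (Const 1))) decide_edge,
     Assign ''i'' (Const 0),
     While (Less (Var ''i'') (Var ''m'')) set_bend,
     Assign ''ans'' (Var ''ok'')]"

lemmas program_defs = set_ends_def insert_slot_def set_slots_def visit_def conflict_arrays_def
  expand_def start_def commit_one_def commit_def start_both_def try_both_def decide_edge_def
  set_bend_def program_def

lemma tame_program: "tame {''n'', ''m''} program"
  by (simp add: program_defs)

lemma loop_free_parts:
  "loop_free set_ends" "loop_free set_slots" "loop_free (expand k)" "loop_free start_both"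
  "loop_free (commit_one k)" "loop_free set_bend"
  by (auto simp: program_defs)

definition expand_time :: nat where
  "expand_time = tm (expand ''1'') + tm (expand ''2'') + 1"

text \<open>The factor 2 comes from bounding the commit loop:
  \<open>(r + 2) * D \<le> (r + 1) * (2 * D)\<close>, where \<open>r\<close> is the number of
  lockstep rounds. The remaining constants leave slack.\<close>

definition round_time :: nat where
  "round_time = tm start_both + 3 * (expand_time + 1 + bcost undecided) +
     2 * (tm (commit_one ''1'') + tm (commit_one ''2'') + 10) + bcost (won ''1'') + bcost (won ''2'') + 10"

definition decide_time :: nat where
  "decide_time = round_time + 30"

text \<open>The slots are set for \<open>m + m\<close> literals, hence the 2. The main loop starts
  with potential \<open>(5 * m + 1) * decide_time\<close>, hence the 5.\<close>

definition total_time :: nat where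
  "total_time = tm set_ends + 2 * tm set_slots + 5 * decide_time + tm set_bend + 100"

definition frame :: "string set \<Rightarrow> string set \<Rightarrow> state \<Rightarrow> state \<Rightarrow> bool" where
  "frame R A s s' \<longleftrightarrow> (\<forall>r. r \<notin> R \<longrightarrow> fst s' r = fst s r) \<and> (\<forall>a. a \<notin> A \<longrightarrow> snd s' a = snd s a)"

lemma frame_refl: "frame R A s s"
  by (simp add: frame_def)

lemma frame_trans: "frame R A s s' \<Longrightarrow> frame R A s' s'' \<Longrightarrow> frame R A s s''"
  by (simp add: frame_def)

lemma frame_mono: "frame R A s s' \<Longrightarrow> R \<subseteq> R' \<Longrightarrow> A \<subseteq> A' \<Longrightarrow> frame R' A' s s'"
  unfolding frame_def by blast

lemma frame_simps:
  assumes "frame R A s s'"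
  shows "r \<notin> R \<Longrightarrow> fst s' r = fst s r" "a \<notin> A \<Longrightarrow> snd s' a = snd s a"
  using assms by (simp_all add: frame_def)

definition entry :: "nat list \<Rightarrow> nat \<Rightarrow> nat" where
  "entry ls j = (if j < length ls then Suc (ls ! j) else 0)"

lemma entry_Cons: "entry (l # ls) 0 = Suc l" "entry (l # ls) (Suc j) = entry ls j"
  by (simp_all add: entry_def)

section \<open>Slots, conflicts and the bound on the users of a slot\<close>

locale grid_instance =
  fixes n m :: nat and x y sr ds :: "nat \<Rightarrow> nat"
  assumes ends: "k < m \<Longrightarrow> sr k < n" "k < m \<Longrightarrow> ds k < n" "k < m \<Longrightarrow> sr k \<noteq> ds k"
    and deg: "u < n \<Longrightarrow> card {k. k < m \<and> (sr k = u \<or> ds k = u)} \<le> 4"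
begin

abbreviation N :: nat where "N \<equiv> m + m"

definition ng :: "nat \<Rightarrow> nat" where
  "ng l = (if l < m then l + m else l - m)"

definition va :: "nat \<Rightarrow> nat" where
  "va l = (if l < m then sr l else ds (l - m))"

definition ho :: "nat \<Rightarrow> nat" where
  "ho l = (if l < m then ds l else sr (l - m))"

definition vslot :: "nat \<Rightarrow> nat" where
  "vslot l = (if y (va l) < y (ho l) then va l else va l + n)"

definition hslot :: "nat \<Rightarrow> nat" where
  "hslot l = (if x (ho l) < x (va l) then ho l + n + n else ho l + n + n + n)"

definition cf :: "nat \<Rightarrow> nat \<Rightarrow> bool" where
  "cf a b \<longleftrightarrow> a < N \<and> b < N \<and> a \<noteq> b \<and> (vslot a = vslot b \<or> hslot a = hslot b)"

sublocale two_sat N ng cf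
  by unfold_locales (auto simp: ng_def cf_def)

text \<open>Newest literal first, in the order in which \<open>insert_slot\<close> stores them, but
  not cut off after four entries.\<close>

definition users :: "nat \<Rightarrow> nat \<Rightarrow> nat list" where
  "users r \<sigma> = rev (filter (\<lambda>l. vslot l = \<sigma> \<or> hslot l = \<sigma>) [0..<r])"

lemma va_ho:
  assumes "l < N"
  shows "va l < n" "ho l < n" "va l \<noteq> ho l" "va (ng l) = ho l" "ho (ng l) = va l"
proof -
  have "l - m < m" if "\<not> l < m" using that assms by simp
  then show "va l < n" "ho l < n" "va l \<noteq> ho l" "va (ng l) = ho l" "ho (ng l) = va l"
    using assms ends[of l] ends(1,2)[of "l - m"] ends(3)[of "l - m", symmetric]
    by (auto simp: va_def ho_def ng_def)
qed

text \<open>Vertical slots are below \<open>n + n\<close>, horizontal ones are not.\<close>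

lemma vslot_hslot: "a < N \<Longrightarrow> b < N \<Longrightarrow> vslot a \<noteq> hslot b"
  using va_ho[of a] va_ho[of b] by (auto simp: vslot_def hslot_def)

lemma users_Suc:
  "users (Suc r) \<sigma> = (if vslot r = \<sigma> \<or> hslot r = \<sigma> then [r] else []) @ users r \<sigma>"
  by (simp add: users_def)

lemma vslot_eq: "a < N \<Longrightarrow> b < N \<Longrightarrow> vslot a = vslot b \<Longrightarrow> va a = va b"
  using va_ho[of a] va_ho[of b] by (auto simp: vslot_def split: if_splits)

lemma hslot_eq: "a < N \<Longrightarrow> b < N \<Longrightarrow> hslot a = hslot b \<Longrightarrow> ho a = ho b"
  using va_ho[of a] va_ho[of b] by (auto simp: hslot_def split: if_splits)

text \<open>The other shape of an edge exchanges its vertical and its horizontal end, so the two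
  literals use slots of different vertices in either orientation.\<close>

lemma not_cf_ng: "a < N \<Longrightarrow> \<not> cf a (ng a)"
  using vslot_eq[of a "ng a"] hslot_eq[of a "ng a"] va_ho[of a] ng_less[of a]
  by (auto simp: cf_def)

text \<open>Users of one slot conflict pairwise, whereas the two literals of an edge do not. So they
  belong to distinct edges, all incident to the vertex \<open>u\<close> of the slot, and the degree
  bound applies.\<close>

lemma length_users: "length (users N \<sigma>) \<le> 4"
proof -
  let ?U = "set (users N \<sigma>)"
  have U: "l < N" "vslot l = \<sigma> \<or> hslot l = \<sigma>" if "l \<in> ?U" for l
    using that by (auto simp: users_def)
  have "distinct (users N \<sigma>)" by (simp add: users_def)
  then have len: "length (users N \<sigma>) = card ?U" by (simp add: distinct_card)
  show ?thesis
  proof (cases "?U = {}")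
    case False
    then obtain a where a: "a \<in> ?U" by (metis all_not_in_conv)
    define u where "u = (if vslot a = \<sigma> then va a else ho a)"
    have u: "u < n" using U[OF a] va_ho u_def by simp
    have cfU: "cf b l" if "b \<in> ?U" "l \<in> ?U" "b \<noteq> l" for b l
      using U[OF that(1)] U[OF that(2)] vslot_hslot[of b l] vslot_hslot[of l b] that(3)
      by (auto simp: cf_def)
    have inc: "va l = u \<or> ho l = u" if "l \<in> ?U" for l
      using U[OF a] U[OF that] vslot_hslot[of a l] vslot_hslot[of l a] vslot_eq[of a l]
        hslot_eq[of a l] by (auto simp: u_def)
    let ?e = "\<lambda>l. if l < m then l else l - m"
    have "inj_on ?e ?U"
    proof (rule inj_onI, rule ccontr)
      fix b l assume bl: "b \<in> ?U" "l \<in> ?U" "?e b = ?e l" "b \<noteq> l"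
      then have "l = ng b" using U(1)[of b] U(1)[of l] by (auto simp: ng_def split: if_splits)
      with cfU[OF bl(1,2,4)] not_cf_ng U(1)[OF bl(1)] show False by blast
    qed
    moreover have "?e ` ?U \<subseteq> {k. k < m \<and> (sr k = u \<or> ds k = u)}"
      using inc U(1) by (force simp: va_def ho_def)
    ultimately have "card ?U \<le> card {k. k < m \<and> (sr k = u \<or> ds k = u)}"
      using card_inj_on_le[of ?e ?U] by simp
    then show ?thesis using deg[OF u] len by simp
  qed (use len in simp)
qed

section \<open>Memory contents and the two setup loops\<close>

definition data :: "state \<Rightarrow> bool" where
  "data s \<longleftrightarrow> fst s ''n'' = n \<and> fst s ''m'' = m \<and> snd s ''x'' = x \<and> snd s ''y'' = y"

definition ends_set :: "state \<Rightarrow> bool" where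
  "ends_set s \<longleftrightarrow> (\<forall>l<N. snd s ''va'' l = va l \<and> snd s ''ho'' l = ho l \<and> snd s ''g'' l = ng l)"

definition slots_set :: "nat \<Rightarrow> state \<Rightarrow> bool" where
  "slots_set r s \<longleftrightarrow> (\<forall>l<r. snd s ''A'' l = vslot l \<and> snd s ''B'' l = hslot l) \<and>
     (\<forall>\<sigma>. snd s ''O0'' \<sigma> = entry (users r \<sigma>) 0 \<and> snd s ''O1'' \<sigma> = entry (users r \<sigma>) (Suc 0) \<and>
       snd s ''O2'' \<sigma> = entry (users r \<sigma>) (Suc (Suc 0)) \<and>
       snd s ''O3'' \<sigma> = entry (users r \<sigma>) (Suc (Suc (Suc 0))))"

lemma data_frame:
  "data s \<Longrightarrow> frame R A s s' \<Longrightarrow> {''n'', ''m''} \<inter> R = {} \<Longrightarrow> {''x'', ''y''} \<inter> A = {} \<Longrightarrow> data s'"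
  by (simp add: data_def frame_def)

lemma ends_set_frame:
  "ends_set s \<Longrightarrow> frame R A s s' \<Longrightarrow> {''va'', ''ho'', ''g''} \<inter> A = {} \<Longrightarrow> ends_set s'"
  by (simp add: ends_set_def frame_def)

lemma slots_set_frame:
  "slots_set r s \<Longrightarrow> frame R A s s' \<Longrightarrow>
    {''A'', ''B'', ''O0'', ''O1'', ''O2'', ''O3''} \<inter> A = {} \<Longrightarrow> slots_set r s'"
  by (simp add: slots_set_def frame_def)

lemma ok_set_ends:
  assumes "data s" "fst s ''i'' = 0" "snd s ''src'' = sr" "snd s ''dst'' = ds"
  shows "ok (While (Less (Var ''i'') (Var ''m'')) set_ends) s
    (\<lambda>t s'. t \<le> (m + 1) * (tm set_ends + 4) \<and> data s' \<and> ends_set s' \<and>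
      frame {''i''} {''va'', ''ho'', ''g''} s s')"
proof -
  define I where "I r s' \<longleftrightarrow> data s' \<and> fst s' ''i'' = r \<and> r \<le> m \<and>
    frame {''i''} {''va'', ''ho'', ''g''} s s' \<and>
    (\<forall>k<r. snd s' ''va'' k = sr k \<and> snd s' ''va'' (k + m) = ds k \<and>
      snd s' ''ho'' k = ds k \<and> snd s' ''ho'' (k + m) = sr k \<and>
      snd s' ''g'' k = k + m \<and> snd s' ''g'' (k + m) = k)" for r and s' :: state
  have step: "r < m \<and> ok set_ends s1 (\<lambda>t s'. t \<le> tm set_ends \<and> I (Suc r) s')"
    if I: "I r s1" and b: "bval (Less (Var ''i'') (Var ''m'')) s1" for r s1
  proof
    show r: "r < m" using I b by (simp add: I_def data_def)
    have "snd s1 ''src'' = sr" "snd s1 ''dst'' = ds"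
      using I assms frame_simps[of "{''i''}" "{''va'', ''ho'', ''g''}" s s1] by (simp_all add: I_def)
    moreover have "frame {''i''} {''va'', ''ho'', ''g''} s1 (eff set_ends s1)"
      by (simp add: frame_def set_ends_def)
    ultimately have "I (Suc r) (eff set_ends s1)"
      using I r unfolding I_def
      by (intro conjI, simp_all add: set_ends_def data_def) (auto simp: frame_def less_Suc_eq)
    then show "ok set_ends s1 (\<lambda>t s'. t \<le> tm set_ends \<and> I (Suc r) s')"
      by (auto intro: ok_weaken[OF ok_loop_free[OF loop_free_parts(1)]])
  qed
  have "I 0 s" using assms by (simp add: I_def frame_refl)
  from ok_While_count[OF this step] show ?thesis
  proof (rule ok_weaken)
    fix t s' assume "\<exists>r'\<ge>0. I r' s' \<and> \<not> bval (Less (Var ''i'') (Var ''m'')) s' \<and>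
      t \<le> (r' - 0) * (tm set_ends + 1 + bcost (Less (Var ''i'') (Var ''m''))) + 1 +
        bcost (Less (Var ''i'') (Var ''m''))"
    then have I: "I m s'" and t: "t \<le> m * (tm set_ends + 4) + 4"
      by (auto simp: I_def data_def algebra_simps)
    have "ends_set s'" unfolding ends_set_def
    proof (intro allI impI)
      fix l assume "l < N"
      then consider "l < m" | k where "l = k + m" "k < m"
        by (metis add.commute add_less_cancel_left le_add_diff_inverse not_less)
      then show "snd s' ''va'' l = va l \<and> snd s' ''ho'' l = ho l \<and> snd s' ''g'' l = ng l"
        using I by cases (auto simp: I_def va_def ho_def ng_def)
    qed
    with I t show "t \<le> (m + 1) * (tm set_ends + 4) \<and> data s' \<and> ends_set s' \<and>
      frame {''i''} {''va'', ''ho'', ''g''} s s'"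
      by (simp add: I_def)
  qed
qed

text \<open>\<open>L\<close> gives the full list of every slot, of which the arrays show the first
  four entries. Shifting then agrees with \<open>Cons\<close> for lists of any length.\<close>

lemma eff_insert_slot:
  assumes "s' = eff insert_slot s" "fst s ''s'' = \<tau>"
    "\<forall>\<sigma>. snd s ''O0'' \<sigma> = entry (L \<sigma>) 0 \<and> snd s ''O1'' \<sigma> = entry (L \<sigma>) (Suc 0) \<and>
       snd s ''O2'' \<sigma> = entry (L \<sigma>) (Suc (Suc 0)) \<and> snd s ''O3'' \<sigma> = entry (L \<sigma>) (Suc (Suc (Suc 0)))"
    "L' = L(\<tau> := fst s ''i'' # L \<tau>)"
  shows "(\<forall>\<sigma>. snd s' ''O0'' \<sigma> = entry (L' \<sigma>) 0 \<and> snd s' ''O1'' \<sigma> = entry (L' \<sigma>) (Suc 0) \<and>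
       snd s' ''O2'' \<sigma> = entry (L' \<sigma>) (Suc (Suc 0)) \<and>
       snd s' ''O3'' \<sigma> = entry (L' \<sigma>) (Suc (Suc (Suc 0)))) \<and>
     frame {} {''O0'', ''O1'', ''O2'', ''O3''} s s'"
  using assms(2,3) unfolding assms(1,4) by (simp add: insert_slot_def frame_def entry_Cons)

lemma ok_set_slots:
  assumes "data s" "ends_set s" "slots_set 0 s" "fst s ''i'' = 0"
  shows "ok (While (Less (Var ''i'') (Add (Var ''m'') (Var ''m''))) set_slots) s
    (\<lambda>t s'. t \<le> (N + 1) * (tm set_slots + 6) \<and> data s' \<and> ends_set s' \<and> slots_set N s' \<and>
      frame {''i'', ''s''} {''A'', ''B'', ''O0'', ''O1'', ''O2'', ''O3''} s s')"
proof -
  let ?R = "{''i'', ''s''}" and ?A = "{''A'', ''B'', ''O0'', ''O1'', ''O2'', ''O3''}"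
  let ?b = "Less (Var ''i'') (Add (Var ''m'') (Var ''m''))"
  define I where "I r s' \<longleftrightarrow> data s' \<and> ends_set s' \<and> slots_set r s' \<and> fst s' ''i'' = r \<and> r \<le> N \<and>
    frame ?R ?A s s'" for r and s' :: state
  have step: "r < N \<and> ok set_slots s0 (\<lambda>t s'. t \<le> tm set_slots \<and> I (Suc r) s')"
    if I: "I r s0" and b: "bval ?b s0" for r s0
  proof
    show r: "r < N" using I b by (simp add: I_def data_def)
    \<comment> \<open>The loop body is cut at its two insertions. The pieces are evaluated one by
      one and put together again in the fact \<open>eff\<close>.\<close>
    define s1 where "s1 = ((fst s0)(''s'' := vslot r), (snd s0)(''A'' := (snd s0 ''A'')(r := vslot r)))"
    define s2 where "s2 = eff insert_slot s1"
    define s3 where "s3 = ((fst s2)(''s'' := hslot r), (snd s2)(''B'' := (snd s2 ''B'')(r := hslot r)))"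
    define s4 where "s4 = eff insert_slot s3"
    define L where "L = users r"
    define L1 where "L1 = L(vslot r := r # L (vslot r))"
    define L2 where "L2 = L1(hslot r := r # L1 (hslot r))"
    \<comment> \<open>As \<open>vslot r\<close> and \<open>hslot r\<close> differ, the two
      insertions go to different lists and no list receives \<open>r\<close> twice.\<close>
    have L2: "L2 \<sigma> = users (Suc r) \<sigma>" for \<sigma>
      using vslot_hslot[OF r r] by (auto simp: L2_def L1_def L_def users_Suc)
    have i0: "fst s0 ''i'' = r" using I by (simp add: I_def)
    note ins2 = eff_insert_slot[of s2 s1 "vslot r" L L1]
    have f2: "(\<forall>\<sigma>. snd s2 ''O0'' \<sigma> = entry (L1 \<sigma>) 0 \<and> snd s2 ''O1'' \<sigma> = entry (L1 \<sigma>) (Suc 0) \<and>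
       snd s2 ''O2'' \<sigma> = entry (L1 \<sigma>) (Suc (Suc 0)) \<and>
       snd s2 ''O3'' \<sigma> = entry (L1 \<sigma>) (Suc (Suc (Suc 0)))) \<and>
       frame {} {''O0'', ''O1'', ''O2'', ''O3''} s1 s2"
      using I i0 by (intro ins2) (simp_all add: s2_def s1_def L1_def L_def I_def slots_set_def)
    then have i2: "fst s2 ''i'' = r" using i0 by (simp add: frame_def s1_def)
    note ins4 = eff_insert_slot[of s4 s3 "hslot r" L1 L2]
    have f4: "(\<forall>\<sigma>. snd s4 ''O0'' \<sigma> = entry (L2 \<sigma>) 0 \<and> snd s4 ''O1'' \<sigma> = entry (L2 \<sigma>) (Suc 0) \<and>
       snd s4 ''O2'' \<sigma> = entry (L2 \<sigma>) (Suc (Suc 0)) \<and>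
       snd s4 ''O3'' \<sigma> = entry (L2 \<sigma>) (Suc (Suc (Suc 0)))) \<and>
       frame {} {''O0'', ''O1'', ''O2'', ''O3''} s3 s4"
      using f2 i2 by (intro ins4) (simp_all add: s4_def s3_def L2_def)
    have fr: "frame ?R ?A s0 s4"
      using f2 f4 by (simp add: frame_def s1_def s3_def)
    have AB: "snd s4 ''A'' = (snd s0 ''A'')(r := vslot r)" "snd s4 ''B'' = (snd s0 ''B'')(r := hslot r)"
      "fst s4 ''i'' = r"
      using f2 f4 i0 by (simp_all add: frame_def s1_def s3_def)
    have e: "snd s0 ''va'' r = va r" "snd s0 ''ho'' r = ho r" "snd s0 ''x'' = x" "snd s0 ''y'' = y"
      "fst s0 ''n'' = n"
      using I r by (simp_all add: I_def ends_set_def data_def)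
    have s1: "s1 = eff (block [Cond (Less (Read ''y'' (Read ''va'' (Var ''i'')))
         (Read ''y'' (Read ''ho'' (Var ''i''))))
       (Assign ''s'' (Read ''va'' (Var ''i'')))
       (Assign ''s'' (Add (Read ''va'' (Var ''i'')) (Var ''n''))),
     Store ''A'' (Var ''i'') (Var ''s'')]) s0"
      using e i0 by (simp add: s1_def vslot_def)
    have e2: "snd s2 ''va'' r = va r" "snd s2 ''ho'' r = ho r" "snd s2 ''x'' = x" "snd s2 ''y'' = y"
      "fst s2 ''n'' = n"
      using f2 e by (simp_all add: frame_def s1_def)
    have s3: "s3 = eff (block [Cond (Less (Read ''x'' (Read ''ho'' (Var ''i'')))
         (Read ''x'' (Read ''va'' (Var ''i''))))
       (Assign ''s'' (Add (Add (Read ''ho'' (Var ''i'')) (Var ''n'')) (Var ''n'')))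
       (Assign ''s'' (Add (Add (Add (Read ''ho'' (Var ''i'')) (Var ''n'')) (Var ''n'')) (Var ''n''))),
     Store ''B'' (Var ''i'') (Var ''s'')]) s2"
      using e2 i2 by (simp add: s3_def hslot_def)
    have eff: "eff set_slots s0 = ((fst s4)(''i'' := Suc r), snd s4)"
      using AB(3) unfolding s4_def s3 s2_def s1 by (simp add: set_slots_def del: eff.simps(5))
    have fr': "frame ?R ?A s0 (eff set_slots s0)"
      using fr unfolding eff by (simp add: frame_def)
    moreover have "slots_set (Suc r) (eff set_slots s0)"
      using I f4 AB unfolding eff by (auto simp: slots_set_def I_def less_Suc_eq L2)
    ultimately have "I (Suc r) (eff set_slots s0)"
      using I r data_frame[OF _ fr'] ends_set_frame[OF _ fr'] frame_trans[OF _ fr']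
      unfolding I_def by (simp add: eff)
    then show "ok set_slots s0 (\<lambda>t s'. t \<le> tm set_slots \<and> I (Suc r) s')"
      by (auto intro: ok_weaken[OF ok_loop_free[OF loop_free_parts(2)]])
  qed
  have "I 0 s" using assms by (simp add: I_def frame_refl)
  from ok_While_count[OF this step] show ?thesis
  proof (rule ok_weaken)
    fix t s' assume "\<exists>r'\<ge>0. I r' s' \<and> \<not> bval ?b s' \<and>
      t \<le> (r' - 0) * (tm set_slots + 1 + bcost ?b) + 1 + bcost ?b"
    then have I: "I N s'" and t: "t \<le> N * (tm set_slots + 6) + 6"
      by (auto simp: I_def data_def algebra_simps)
    then show "t \<le> (N + 1) * (tm set_slots + 6) \<and> data s' \<and> ends_set s' \<and> slots_set N s' \<and>
      frame ?R ?A s s'"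
      by (simp add: I_def)
  qed
qed

section \<open>Expansion of a queue entry by the program\<close>

definition chosen :: "state \<Rightarrow> nat set" where
  "chosen s = {l. l < N \<and> snd s ''v'' l \<noteq> 0}"

definition env :: "state \<Rightarrow> bool" where
  "env s \<longleftrightarrow> data s \<and> ends_set s \<and> slots_set N s"

lemma env_frame:
  assumes "env s" "frame R A s s'" "{''n'', ''m''} \<inter> R = {}"
    "{''x'', ''y'', ''va'', ''ho'', ''g'', ''A'', ''B'', ''O0'', ''O1'', ''O2'', ''O3''} \<inter> A = {}"
  shows "env s'"
  using assms data_frame[OF _ assms(2)] ends_set_frame[OF _ assms(2)] slots_set_frame[OF _ assms(2)]
  unfolding env_def by simp

lemma chosen_frame: "frame R A s s' \<Longrightarrow> ''v'' \<notin> A \<Longrightarrow> chosen s' = chosen s"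
  by (simp add: chosen_def frame_def)

definition world :: "string \<Rightarrow> state \<Rightarrow> (nat \<Rightarrow> nat) \<times> (nat \<Rightarrow> nat) \<times> nat \<times> nat" where
  "world k s = (snd s (CHR ''M'' # k), snd s (CHR ''q'' # k), fst s (CHR ''t'' # k), fst s (CHR ''c'' # k))"

text \<open>A nonzero entry is at most \<open>N\<close>, so its predecessor is a literal and
  \<open>g\<close> holds its negation. An empty entry fails the first test.\<close>

lemma eff_visit:
  assumes "ends_set s" "snd s U (snd s A (fst s ''l'')) \<le> N"
  shows "world k (eff (visit k A U) s) =
      visited (chosen s) (fst s ''p'') (fst s ''l'') (snd s U (snd s A (fst s ''l''))) (world k s)"
    and "frame {''z'', ''a'', CHR ''t'' # k, CHR ''c'' # k} {CHR ''M'' # k, CHR ''q'' # k}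
      s (eff (visit k A U) s)"
proof -
  define z where "z = snd s U (snd s A (fst s ''l''))"
  have z: "snd s ''g'' (z - Suc 0) = ng (z - Suc 0)" "ng (z - Suc 0) < N" "ng (ng (z - Suc 0)) = z - Suc 0"
    if "z \<noteq> 0" using assms that ng_less[of "z - Suc 0"] ng_ng[of "z - Suc 0"]
    unfolding ends_set_def z_def by auto
  show "world k (eff (visit k A U) s) =
      visited (chosen s) (fst s ''p'') (fst s ''l'') (snd s U (snd s A (fst s ''l''))) (world k s)"
    using z unfolding z_def[symmetric] visit_def world_def chosen_def
    by (simp add: z_def[symmetric])
  show "frame {''z'', ''a'', CHR ''t'' # k, CHR ''c'' # k} {CHR ''M'' # k, CHR ''q'' # k}
      s (eff (visit k A U) s)"
    by (simp add: visit_def frame_def)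
qed

text \<open>The arrays that are read differ from the two that are written, so the whole conflict
  list can be taken from the initial state.\<close>

lemma eff_visits:
  assumes "ends_set s"
    "\<And>A U. (A, U) \<in> set ps \<Longrightarrow> snd s U (snd s A (fst s ''l'')) \<le> N \<and>
       {A, U} \<inter> {CHR ''M'' # k, CHR ''q'' # k} = {}"
  shows "world k (eff (block (map (\<lambda>(A, U). visit k A U) ps)) s) =
      fold (visited (chosen s) (fst s ''p'') (fst s ''l''))
        (map (\<lambda>(A, U). snd s U (snd s A (fst s ''l''))) ps) (world k s) \<and>
    frame {''z'', ''a'', CHR ''t'' # k, CHR ''c'' # k} {CHR ''M'' # k, CHR ''q'' # k}
      s (eff (block (map (\<lambda>(A, U). visit k A U) ps)) s)"
  using assms
proof (induction ps arbitrary: s)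
  case Nil
  then show ?case by (simp add: frame_refl)
next
  case (Cons p ps)
  obtain A U where p: "p = (A, U)" by (cases p)
  let ?s1 = "eff (visit k A U) s"
  have AU: "snd s U (snd s A (fst s ''l'')) \<le> N" using Cons.prems(2)[of A U] p by simp
  note w = eff_visit(1)[OF Cons.prems(1) AU, of k] and f = eff_visit(2)[OF Cons.prems(1) AU, of k]
  have eqs: "fst ?s1 ''l'' = fst s ''l''" "fst ?s1 ''p'' = fst s ''p''" "chosen ?s1 = chosen s"
    "ends_set ?s1"
    using frame_simps(1)[OF f] chosen_frame[OF f] ends_set_frame[OF Cons.prems(1) f] by simp_all
  have arr: "snd ?s1 B = snd s B \<and> snd ?s1 V = snd s V" if "(B, V) \<in> set ps" for B V
    using Cons.prems(2)[of B V] that frame_simps(2)[OF f, of B] frame_simps(2)[OF f, of V] by auto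
  have IH: "world k (eff (block (map (\<lambda>(A, U). visit k A U) ps)) ?s1) =
      fold (visited (chosen ?s1) (fst ?s1 ''p'') (fst ?s1 ''l''))
        (map (\<lambda>(A, U). snd ?s1 U (snd ?s1 A (fst ?s1 ''l''))) ps) (world k ?s1) \<and>
    frame {''z'', ''a'', CHR ''t'' # k, CHR ''c'' # k} {CHR ''M'' # k, CHR ''q'' # k}
      ?s1 (eff (block (map (\<lambda>(A, U). visit k A U) ps)) ?s1)"
  proof (rule Cons.IH[OF eqs(4)])
    fix B V assume "(B, V) \<in> set ps"
    then show "snd ?s1 V (snd ?s1 B (fst ?s1 ''l'')) \<le> N \<and> {B, V} \<inter> {CHR ''M'' # k, CHR ''q'' # k} = {}"
      using Cons.prems(2)[of B V] arr[of B V] eqs by simp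
  qed
  have maps: "map (\<lambda>(A, U). snd ?s1 U (snd ?s1 A (fst ?s1 ''l''))) ps =
      map (\<lambda>(A, U). snd s U (snd s A (fst s ''l''))) ps"
  proof (rule map_cong[OF refl])
    fix b assume b: "b \<in> set ps"
    obtain B V where "b = (B, V)" by (cases b)
    with b arr[of B V] eqs show "(case b of (A, U) \<Rightarrow> snd ?s1 U (snd ?s1 A (fst ?s1 ''l''))) =
        (case b of (A, U) \<Rightarrow> snd s U (snd s A (fst s ''l'')))" by simp
  qed
  note IH = IH[unfolded maps, unfolded eqs w]
  show ?case
    using IH frame_trans[OF f] unfolding p by simp
qed

text \<open>The result of the eight reads along \<open>conflict_arrays\<close>, in the same order. A
  literal occupies its own slots and so appears in its own list; therefore a visit skips
  \<open>z - 1 = l\<close>.\<close>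

definition conflicts :: "nat \<Rightarrow> nat list" where
  "conflicts l = map (\<lambda>(\<sigma>, j). entry (users N \<sigma>) j)
    (List.product [vslot l, hslot l] [0, Suc 0, Suc (Suc 0), Suc (Suc (Suc 0))])"

lemma entry_users: "entry (users N \<sigma>) j \<le> N"
proof -
  have "a < N" if "a \<in> set (users N \<sigma>)" for a using that by (simp add: users_def)
  then show ?thesis unfolding entry_def using nth_mem by (simp add: Suc_le_eq)
qed

lemma conflicts_sound:
  assumes "l < N" "z \<in> set (conflicts l)" "0 < z" "z - 1 \<noteq> l"
  shows "cf l (z - 1)"
proof -
  obtain \<sigma> j where \<sigma>: "\<sigma> = vslot l \<or> \<sigma> = hslot l" "z = entry (users N \<sigma>) j"
    using assms(2) by (auto simp: conflicts_def)
  then have "z - 1 \<in> set (users N \<sigma>)" using assms(3) by (auto simp: entry_def split: if_splits)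
  then have "z - 1 < N" "vslot (z - 1) = \<sigma> \<or> hslot (z - 1) = \<sigma>" by (auto simp: users_def)
  with \<sigma>(1) assms(1,4) vslot_hslot[of l "z - 1"] vslot_hslot[of "z - 1" l] show ?thesis
    by (auto simp: cf_def)
qed

text \<open>Here the degree bound makes constant-time expansion possible: four entries exhaust the
  users of a slot.\<close>

lemma conflicts_complete:
  assumes "cf l b"
  shows "Suc b \<in> set (conflicts l)"
proof -
  have b: "b < N" using assms by (simp add: cf_def)
  obtain \<sigma> where \<sigma>: "\<sigma> = vslot l \<or> \<sigma> = hslot l" "vslot b = \<sigma> \<or> hslot b = \<sigma>"
    using assms unfolding cf_def by metis
  then have "b \<in> set (users N \<sigma>)" using b by (auto simp: users_def)
  then obtain j where j: "j < length (users N \<sigma>)" "users N \<sigma> ! j = b"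
    by (metis in_set_conv_nth)
  then have "j < 4" using length_users[of \<sigma>] by simp
  then have "j \<in> {0, Suc 0, Suc (Suc 0), Suc (Suc (Suc 0))}" by auto
  moreover have "Suc b = entry (users N \<sigma>) j" using j by (simp add: entry_def)
  ultimately show ?thesis using \<sigma>(1) by (auto simp: conflicts_def)
qed

text \<open>The head \<open>h\<close> separates expanded entries from pending ones. Once it reaches
  \<open>t\<close>, the closure clause turns into the hypothesis of
  \<open>commit_closed\<close>.\<close>

definition running :: "string \<Rightarrow> nat \<Rightarrow> state \<Rightarrow> bool" where
  "running k l\<^sub>0 s \<longleftrightarrow>
     propagation l\<^sub>0 (chosen s) (fst s ''p'') (snd s (CHR ''M'' # k)) (snd s (CHR ''q'' # k))
       (fst s (CHR ''t'' # k)) (fst s (CHR ''c'' # k)) \<and>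
     fst s (CHR ''h'' # k) \<le> fst s (CHR ''t'' # k) \<and>
     (fst s (CHR ''c'' # k) = 0 \<longrightarrow>
       closed_under (chosen s \<union> snd s (CHR ''q'' # k) ` {..<fst s (CHR ''t'' # k)})
         (snd s (CHR ''q'' # k) ` {..<fst s (CHR ''h'' # k)}))"

lemma running_frame:
  assumes "running k l\<^sub>0 s" "frame R A s s'"
    "{''p'', CHR ''t'' # k, CHR ''h'' # k, CHR ''c'' # k} \<inter> R = {}"
    "{''v'', CHR ''M'' # k, CHR ''q'' # k} \<inter> A = {}"
  shows "running k l\<^sub>0 s'"
  using assms(1,3,4) frame_simps[OF assms(2)] chosen_frame[OF assms(2)] unfolding running_def by simp

definition regs :: "string \<Rightarrow> string set" where
  "regs k = {''z'', ''a'', ''l'', CHR ''h'' # k, CHR ''t'' # k, CHR ''c'' # k}"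

text \<open>The last conclusion ties the head of a propagation without contradiction to the number
  of expansions made so far.\<close>

lemma eff_expand:
  assumes env: "env s" and Y: "closed_under (chosen s) (chosen s)" and r: "running k l\<^sub>0 s"
    and h: "fst s (CHR ''c'' # k) = 0 \<Longrightarrow> fst s (CHR ''h'' # k) < fst s (CHR ''t'' # k)"
  shows "frame (regs k) {CHR ''M'' # k, CHR ''q'' # k} s (eff (expand k) s)"
    and "running k l\<^sub>0 (eff (expand k) s)"
    and "fst (eff (expand k) s) (CHR ''c'' # k) = 0 \<Longrightarrow> fst s (CHR ''c'' # k) = 0 \<and>
      fst (eff (expand k) s) (CHR ''h'' # k) = Suc (fst s (CHR ''h'' # k))"
proof -
  let ?h = "CHR ''h'' # k" and ?t = "CHR ''t'' # k" and ?c = "CHR ''c'' # k"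
  let ?M = "CHR ''M'' # k" and ?q = "CHR ''q'' # k"
  let ?s' = "eff (expand k) s"
  have "frame (regs k) {?M, ?q} s ?s' \<and> running k l\<^sub>0 ?s' \<and>
    (fst ?s' ?c = 0 \<longrightarrow> fst s ?c = 0 \<and> fst ?s' ?h = Suc (fst s ?h))"
  proof (cases "fst s ?c = 0")
    case False
    then have "?s' = s" by (simp add: expand_def)
    with False r show ?thesis by (simp add: frame_refl)
  next
    case True
    define l where "l = snd s ?q (fst s ?h)"
    define s1 where "s1 = ((fst s)(''l'' := l, ?h := Suc (fst s ?h)), snd s)"
    have ht: "fst s ?h < fst s ?t" using h True by simp
    note P = r[unfolded running_def, THEN conjunct1]
    have l: "l < N" "l \<in> snd s ?q ` {..<fst s ?t}"
      using P ht unfolding propagation_def l_def by auto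
    have f1: "frame (regs k) {?M, ?q} s s1" by (simp add: s1_def frame_def regs_def)
    have es1: "ends_set s1" "slots_set N s1"
      using env by (simp_all add: env_def ends_set_def slots_set_def s1_def)
    have l1: "fst s1 ''l'' = l" by (simp add: s1_def)
    have zs: "map (\<lambda>(A, U). snd s1 U (snd s1 A l)) conflict_arrays = conflicts l"
      using es1(2) l(1) by (simp add: slots_set_def conflict_arrays_def conflicts_def)
    have s': "?s' = eff (block (map (\<lambda>(A, U). visit k A U) conflict_arrays)) s1"
      using True by (simp add: expand_def s1_def l_def)
    have "world k ?s' = fold (visited (chosen s1) (fst s1 ''p'') (fst s1 ''l''))
        (map (\<lambda>(A, U). snd s1 U (snd s1 A (fst s1 ''l''))) conflict_arrays) (world k s1) \<and>
      frame {''z'', ''a'', ?t, ?c} {?M, ?q} s1 ?s'"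
      unfolding s'
    proof (rule eff_visits[OF es1(1)])
      fix A U assume "(A, U) \<in> set conflict_arrays"
      then show "snd s1 U (snd s1 A (fst s1 ''l'')) \<le> N \<and> {A, U} \<inter> {?M, ?q} = {}"
        using es1(2) entry_users by (auto simp: conflict_arrays_def slots_set_def)
    qed
    moreover have "chosen s1 = chosen s" "fst s1 ''p'' = fst s ''p''" "world k s1 = world k s"
      by (simp_all add: s1_def chosen_def world_def)
    ultimately have w: "fold (visited (chosen s) (fst s ''p'') l) (conflicts l)
        (snd s ?M, snd s ?q, fst s ?t, fst s ?c) = (snd ?s' ?M, snd ?s' ?q, fst ?s' ?t, fst ?s' ?c)"
      and f2: "frame {''z'', ''a'', ?t, ?c} {?M, ?q} s1 ?s'"
      unfolding l1 by (simp_all add: world_def zs)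
    have fr: "frame (regs k) {?M, ?q} s ?s'"
      by (rule frame_trans[OF f1 frame_mono[OF f2]]) (auto simp: regs_def)
    have h': "fst ?s' ?h = Suc (fst s ?h)" using frame_simps(1)[OF f2] by (simp add: s1_def)
    have ch: "chosen ?s' = chosen s" "fst ?s' ''p'' = fst s ''p''"
      using chosen_frame[OF fr] frame_simps(1)[OF fr] by (simp_all add: regs_def)
    have V: "propagation l\<^sub>0 (chosen s) (fst s ''p'') (snd ?s' ?M) (snd ?s' ?q) (fst ?s' ?t) (fst ?s' ?c) \<and>
      fst s ?t \<le> fst ?s' ?t \<and> (\<forall>i<fst s ?t. snd ?s' ?q i = snd s ?q i) \<and>
      (\<forall>z\<in>set (conflicts l). 0 < z \<longrightarrow> z - 1 \<noteq> l \<longrightarrow>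
        ng (z - 1) \<in> chosen s \<union> snd ?s' ?q ` {..<fst ?s' ?t})"
      by (rule propagation_visited[OF P Y l(2) conflicts_sound[OF l(1)] w])
    have img: "snd ?s' ?q ` {..<Suc (fst s ?h)} = insert l (snd s ?q ` {..<fst s ?h})"
    proof -
      have "snd ?s' ?q ` {..<Suc (fst s ?h)} = snd s ?q ` {..<Suc (fst s ?h)}"
        using V ht by (intro image_cong) auto
      then show ?thesis by (simp add: lessThan_Suc l_def)
    qed
    have sub: "snd s ?q ` {..<fst s ?t} \<subseteq> snd ?s' ?q ` {..<fst ?s' ?t}"
    proof
      fix a assume "a \<in> snd s ?q ` {..<fst s ?t}"
      then obtain i where "i < fst s ?t" "a = snd s ?q i" by auto
      then have "i < fst ?s' ?t" "a = snd ?s' ?q i" using V by auto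
      then show "a \<in> snd ?s' ?q ` {..<fst ?s' ?t}" by blast
    qed
    \<comment> \<open>For the entry \<open>l\<close> just expanded, this is completeness of its
      conflict list; for older entries it persists because the queue only grew.\<close>
    have cl: "closed_under (chosen s \<union> snd ?s' ?q ` {..<fst ?s' ?t}) (insert l (snd s ?q ` {..<fst s ?h}))"
      unfolding closed_under_def
    proof (intro ballI allI impI)
      fix a b assume ab: "a \<in> insert l (snd s ?q ` {..<fst s ?h})" "cf a b"
      show "ng b \<in> chosen s \<union> snd ?s' ?q ` {..<fst ?s' ?t}"
      proof (cases "a = l")
        case True
        then have "Suc b \<in> set (conflicts l)" "b \<noteq> l"
          using conflicts_complete ab(2) by (auto simp: cf_def)
        then show ?thesis using V by force
      next
        case False
        then have "a \<in> snd s ?q ` {..<fst s ?h}" using ab(1) by blast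
        then have "ng b \<in> chosen s \<union> snd s ?q ` {..<fst s ?t}"
          using r True ab(2) unfolding running_def closed_under_def by blast
        with sub show ?thesis by blast
      qed
    qed
    have "running k l\<^sub>0 ?s'"
      unfolding running_def ch h' img using V cl ht by simp
    with fr h' True show ?thesis by simp
  qed
  then show "frame (regs k) {?M, ?q} s ?s'" "running k l\<^sub>0 ?s'"
    "fst ?s' ?c = 0 \<Longrightarrow> fst s ?c = 0 \<and> fst ?s' ?h = Suc (fst s ?h)" by blast+
qed

section \<open>One round: both propagations, commit or failure\<close>

lemma running_start:
  assumes "env s" "i < m" "fst s ''i'' = i" "i \<notin> chosen s" "i + m \<notin> chosen s"
    "\<And>a. snd s ''M1'' a \<le> i" "\<And>a. snd s ''M2'' a \<le> i"
  defines "s' \<equiv> eff start_both s"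
  shows "running ''1'' i s'" "running ''2'' (ng i) s'" "fst s' ''p'' = Suc i"
    "fst s' ''h1'' = 0" "fst s' ''h2'' = 0"
    "frame {''p'', ''h1'', ''t1'', ''c1'', ''h2'', ''t2'', ''c2''} {''M1'', ''q1'', ''M2'', ''q2''} s s'"
proof -
  have m: "fst s ''m'' = m" using assms(1) by (simp add: env_def data_def)
  have i: "i < N" "ng i < N" "ng i = i + m" "ng (i + m) = i" using assms(2) by (auto simp: ng_def)
  have ch: "chosen s' = chosen s" by (simp add: s'_def start_both_def start_def chosen_def)
  have M: "snd s ''M1'' a \<noteq> Suc i" "snd s ''M2'' a \<noteq> Suc i"
    "snd s ''M1'' a \<le> Suc i" "snd s ''M2'' a \<le> Suc i" for a
    using assms(6)[of a] assms(7)[of a] by auto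
  have v: "fst s' ''p'' = Suc i" "fst s' ''h1'' = 0" "fst s' ''t1'' = Suc 0" "fst s' ''c1'' = 0"
    "fst s' ''h2'' = 0" "fst s' ''t2'' = Suc 0" "fst s' ''c2'' = 0"
    "snd s' ''M1'' = (snd s ''M1'')(i := Suc i)" "snd s' ''M2'' = (snd s ''M2'')(i + m := Suc i)"
    "snd s' ''q1'' 0 = i" "snd s' ''q2'' 0 = i + m"
    using m assms(3) by (simp_all add: s'_def start_both_def start_def)
  show "running ''1'' i s'"
    unfolding running_def v ch
    using propagation_start[of i "chosen s" "snd s' ''q1''" "(snd s ''M1'')(i := Suc i)" "Suc i"] i M v assms(4,5)
    by (simp add: closed_under_def)
  show "running ''2'' (ng i) s'"
    unfolding running_def v ch i(3)
    using propagation_start[of "i + m" "chosen s" "snd s' ''q2''" "(snd s ''M2'')(i + m := Suc i)" "Suc i"] i M v assms(4,5)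
    by (simp add: closed_under_def)
  show "fst s' ''p'' = Suc i" "fst s' ''h1'' = 0" "fst s' ''h2'' = 0" by (fact v)+
  show "frame {''p'', ''h1'', ''t1'', ''c1'', ''h2'', ''t2'', ''c2''} {''M1'', ''q1'', ''M2'', ''q2''} s s'"
    by (simp add: s'_def start_both_def start_def frame_def)
qed

text \<open>The loop counter \<open>r\<close> equals the head of every propagation that is still
  free of contradiction. A winner thus has exactly \<open>r\<close> literals in its queue, and these
  pay for the loop.\<close>

lemma ok_expands:
  assumes env: "env s" and Y: "closed_under (chosen s) (chosen s)"
    and r: "running ''1'' a s" "running ''2'' b s" "fst s ''h1'' = 0" "fst s ''h2'' = 0"
  shows "ok (While undecided (block [expand ''1'', expand ''2''])) s (\<lambda>t s'.
    \<exists>r. t \<le> (r + 1) * (expand_time + 1 + bcost undecided) \<and> \<not> bval undecided s' \<and> r \<le> N \<and>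
      running ''1'' a s' \<and> running ''2'' b s' \<and>
      (fst s' ''c1'' = 0 \<longrightarrow> fst s' ''h1'' = r) \<and> (fst s' ''c2'' = 0 \<longrightarrow> fst s' ''h2'' = r) \<and>
      frame (regs ''1'' \<union> regs ''2'') {''M1'', ''q1'', ''M2'', ''q2''} s s')"
proof -
  let ?R = "regs ''1'' \<union> regs ''2''" and ?A = "{''M1'', ''q1'', ''M2'', ''q2''}"
  define I where "I r s' \<longleftrightarrow> r \<le> N \<and> running ''1'' a s' \<and> running ''2'' b s' \<and>
      (fst s' ''c1'' = 0 \<longrightarrow> fst s' ''h1'' = r) \<and> (fst s' ''c2'' = 0 \<longrightarrow> fst s' ''h2'' = r) \<and>
      frame ?R ?A s s'" for r and s' :: state
  have step: "r < N \<and> ok (block [expand ''1'', expand ''2'']) s0 (\<lambda>t s'. t \<le> expand_time \<and> I (Suc r) s')"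
    if I: "I r s0" and b: "bval undecided s0" for r s0
  proof
    have fr: "frame ?R ?A s s0" using I by (simp add: I_def)
    have env0: "env s0" by (rule env_frame[OF env fr]) (auto simp: regs_def)
    have Y0: "closed_under (chosen s0) (chosen s0)" using chosen_frame[OF fr] Y by simp
    have h: "fst s0 ''c1'' = 0 \<Longrightarrow> fst s0 ''h1'' < fst s0 ''t1''"
      "fst s0 ''c2'' = 0 \<Longrightarrow> fst s0 ''h2'' < fst s0 ''t2''"
      using I b by (auto simp: I_def running_def undecided_def won_def)
    have t: "fst s0 ''t1'' \<le> N" "fst s0 ''t2'' \<le> N"
      using I propagation_length unfolding I_def running_def by blast+
    \<comment> \<open>One propagation is still alive; its head is \<open>r\<close> and lies strictly
      below its queue length, which is at most \<open>N\<close>.\<close>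
    have "fst s0 ''c1'' = 0 \<or> fst s0 ''c2'' = 0" using b by (auto simp: undecided_def)
    then show r: "r < N" using I h t unfolding I_def by auto
    have r1: "running ''1'' a s0" and r2: "running ''2'' b s0" using I by (auto simp: I_def)
    define s1 where "s1 = eff (expand ''1'') s0"
    define s2 where "s2 = eff (expand ''2'') s1"
    note e1 = eff_expand[OF env0 Y0 r1, folded s1_def]
    have f1: "frame (regs ''1'') {''M1'', ''q1''} s0 s1" by (rule e1(1)) (rule h)
    have r1': "running ''1'' a s1" by (rule e1(2)) (rule h)
    have env1: "env s1" by (rule env_frame[OF env0 f1]) (auto simp: regs_def)
    have Y1: "closed_under (chosen s1) (chosen s1)" using chosen_frame[OF f1] Y0 by simp
    have r2': "running ''2'' b s1" by (rule running_frame[OF r2 f1]) (auto simp: regs_def)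
    have same1: "fst s1 ''c2'' = fst s0 ''c2''" "fst s1 ''h2'' = fst s0 ''h2''" "fst s1 ''t2'' = fst s0 ''t2''"
      using frame_simps(1)[OF f1] by (simp_all add: regs_def)
    note e2 = eff_expand[OF env1 Y1 r2', folded s2_def]
    have h1: "fst s1 ''c2'' = 0 \<Longrightarrow> fst s1 ''h2'' < fst s1 ''t2''" using h(2) same1 by simp
    have f2: "frame (regs ''2'') {''M2'', ''q2''} s1 s2" by (rule e2(1)) (rule h1)
    have r2'': "running ''2'' b s2" by (rule e2(2)) (rule h1)
    have r1'': "running ''1'' a s2" by (rule running_frame[OF r1' f2]) (auto simp: regs_def)
    have same2: "fst s2 ''c1'' = fst s1 ''c1''" "fst s2 ''h1'' = fst s1 ''h1''"
      using frame_simps(1)[OF f2] by (simp_all add: regs_def)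
    have c1: "fst s2 ''h1'' = Suc r" if "fst s2 ''c1'' = 0"
    proof -
      have "fst s0 ''c1'' = 0 \<and> fst s1 ''h1'' = Suc (fst s0 ''h1'')"
        by (rule e1(3)) (use h(1) that same2 in auto)
      then show ?thesis using I same2 by (simp add: I_def)
    qed
    have c2: "fst s2 ''h2'' = Suc r" if "fst s2 ''c2'' = 0"
    proof -
      have "fst s1 ''c2'' = 0 \<and> fst s2 ''h2'' = Suc (fst s1 ''h2'')"
        by (rule e2(3)) (use h1 that in auto)
      then show ?thesis using I same1 by (simp add: I_def)
    qed
    have "frame ?R ?A s s2"
      by (rule frame_trans[OF fr frame_trans[OF frame_mono[OF f1] frame_mono[OF f2]]]) auto
    with r r1'' r2'' c1 c2 have "I (Suc r) s2" by (simp add: I_def)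
    then have "I (Suc r) (eff (block [expand ''1'', expand ''2'']) s0)" by (simp add: s2_def s1_def)
    moreover have "tm (block [expand ''1'', expand ''2'']) = expand_time"
      by (simp add: block_def expand_time_def)
    ultimately show "ok (block [expand ''1'', expand ''2'']) s0 (\<lambda>t s'. t \<le> expand_time \<and> I (Suc r) s')"
      by (intro ok_weaken[OF ok_loop_free]) (auto simp: loop_free_parts)
  qed
  have I0: "I 0 s" using r by (simp add: I_def frame_refl)
  show ?thesis
  proof (rule ok_weaken[OF ok_While_count[OF I0 step]], assumption, assumption, elim exE conjE)
    fix t s' r
    assume t: "t \<le> (r - 0) * (expand_time + 1 + bcost undecided) + 1 + bcost undecided"
      and "I r s'" "\<not> bval undecided s'"
    moreover from t have "t \<le> (r + 1) * (expand_time + 1 + bcost undecided)"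
      by (simp add: algebra_simps)
    ultimately show "\<exists>r. t \<le> (r + 1) * (expand_time + 1 + bcost undecided) \<and>
      \<not> bval undecided s' \<and> r \<le> N \<and> running ''1'' a s' \<and> running ''2'' b s' \<and>
      (fst s' ''c1'' = 0 \<longrightarrow> fst s' ''h1'' = r) \<and> (fst s' ''c2'' = 0 \<longrightarrow> fst s' ''h2'' = r) \<and>
      frame ?R ?A s s'"
      unfolding I_def by (intro exI[of _ r]) blast
  qed
qed

lemma ok_commit:
  assumes "snd s (CHR ''q'' # k) ` {..<fst s (CHR ''t'' # k)} \<subseteq> {..<N}"
  shows "ok (commit k) s (\<lambda>t s'. t \<le> (fst s (CHR ''t'' # k) + 2) * (tm (commit_one k) + 4) \<and>
    frame {''j''} {''v''} s s' \<and>
    chosen s' = chosen s \<union> snd s (CHR ''q'' # k) ` {..<fst s (CHR ''t'' # k)})"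
proof -
  let ?q = "snd s (CHR ''q'' # k)" and ?t = "fst s (CHR ''t'' # k)"
  let ?b = "Less (Var ''j'') (Var (CHR ''t'' # k))"
  define I where "I r s' \<longleftrightarrow> r \<le> ?t \<and> fst s' ''j'' = r \<and> frame {''j''} {''v''} s s' \<and>
    chosen s' = chosen s \<union> ?q ` {..<r}" for r and s' :: state
  have step: "r < ?t \<and> ok (commit_one k) s0 (\<lambda>t s'. t \<le> tm (commit_one k) \<and> I (Suc r) s')"
    if I: "I r s0" and b: "bval ?b s0" for r s0
  proof
    have fr: "frame {''j''} {''v''} s s0" using I by (simp add: I_def)
    then have q: "snd s0 (CHR ''q'' # k) = ?q" "fst s0 (CHR ''t'' # k) = ?t"
      using frame_simps[OF fr] by simp_all
    then show r: "r < ?t" using I b by (simp add: I_def)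
    let ?s' = "eff (commit_one k) s0"
    have "?q r < N" using assms r by auto
    then have "chosen ?s' = insert (?q r) (chosen s0)"
      using q I by (auto simp: I_def commit_one_def chosen_def)
    then have "chosen ?s' = chosen s \<union> ?q ` {..<Suc r}"
      using I by (simp add: I_def lessThan_Suc)
    moreover have "frame {''j''} {''v''} s0 ?s'" by (simp add: frame_def commit_one_def)
    moreover have "fst ?s' ''j'' = Suc r" using I by (simp add: I_def commit_one_def)
    ultimately have "I (Suc r) ?s'" using r frame_trans[OF fr] by (simp add: I_def)
    then show "ok (commit_one k) s0 (\<lambda>t s'. t \<le> tm (commit_one k) \<and> I (Suc r) s')"
      by (auto intro: ok_weaken[OF ok_loop_free[OF loop_free_parts(5)]])
  qed
  define s1 where "s1 = eff (Assign ''j'' (Const 0)) s"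
  have I0: "I 0 s1" by (simp add: I_def s1_def frame_def chosen_def)
  have W: "ok (While ?b (commit_one k)) s1 (\<lambda>t s'. t \<le> ?t * (tm (commit_one k) + 4) + 4 \<and> I ?t s')"
  proof (rule ok_weaken[OF ok_While_count[OF I0 step]], assumption, assumption)
    fix t s' assume "\<exists>r'\<ge>0. I r' s' \<and> \<not> bval ?b s' \<and>
      t \<le> (r' - 0) * (tm (commit_one k) + 1 + bcost ?b) + 1 + bcost ?b"
    then obtain r where r: "I r s'" "\<not> bval ?b s'" "t \<le> r * (tm (commit_one k) + 4) + 4"
      by (auto simp: algebra_simps)
    then have "r = ?t" using frame_simps(1)[of "{''j''}" "{''v''}" s s'] by (simp add: I_def)
    with r show "t \<le> ?t * (tm (commit_one k) + 4) + 4 \<and> I ?t s'" by simp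
  qed
  show ?thesis unfolding commit_def
    apply (rule ok_block_Cons, rule ok_weaken[OF ok_loop_free], simp)
    apply (rule ok_block_Cons, rule ok_weaken)
     apply (erule conjunct2[THEN ssubst])
     apply (rule W[unfolded s1_def])
    apply (rule ok_block_Nil)
    apply (auto simp: I_def algebra_simps)
    done
qed

definition good :: "state \<Rightarrow> bool" where
  "good s \<longleftrightarrow> closed_under (chosen s) (chosen s) \<and> consistent (chosen s)"

lemma chosen_subset: "chosen s \<subseteq> {..<N}"
  by (auto simp: chosen_def)

text \<open>A winner has equal head and tail. So its whole queue is expanded, and the head, that is
  the number of lockstep rounds, measures the time as well as the number of new literals.\<close>

lemma commit_won:
  assumes r: "running k a s" and won: "bval (won k) s" and g: "good s"
  shows "ok (commit k) s (\<lambda>t s'. t \<le> (fst s (CHR ''h'' # k) + 2) * (tm (commit_one k) + 4) \<and>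
    frame {''j''} {''v''} s s' \<and> good s' \<and> a \<in> chosen s' \<and> chosen s \<subseteq> chosen s' \<and>
    card (chosen s') = card (chosen s) + fst s (CHR ''h'' # k))"
proof -
  let ?q = "snd s (CHR ''q'' # k)" and ?t = "fst s (CHR ''t'' # k)"
  have c: "fst s (CHR ''c'' # k) = 0" "fst s (CHR ''h'' # k) = ?t" using won by (auto simp: won_def)
  have P: "propagation a (chosen s) (fst s ''p'') (snd s (CHR ''M'' # k)) ?q ?t 0"
    and cl: "closed_under (chosen s \<union> ?q ` {..<?t}) (?q ` {..<?t})"
    using r c unfolding running_def by simp_all
  note C = commit_closed[OF P cl _ _ chosen_subset]
  have sub: "?q ` {..<?t} \<subseteq> {..<N}" "a \<in> ?q ` {..<?t}" using P unfolding propagation_def by auto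
  show ?thesis
    by (rule ok_weaken[OF ok_commit[OF sub(1)]]) (use C g sub(2) c in \<open>auto simp: good_def\<close>)
qed

text \<open>The number \<open>d\<close> of lockstep rounds has two roles: on success it is the
  number of literals committed, on failure it is merely at most \<open>N\<close> and is paid from
  the reserve.\<close>

lemma ok_try_both:
  assumes env: "env s" and i: "i < m" "fst s ''i'' = i" "i \<notin> chosen s" "i + m \<notin> chosen s"
    and M: "\<And>a. snd s ''M1'' a \<le> i" "\<And>a. snd s ''M2'' a \<le> i"
    and g: "good s" and flag: "fst s ''ok'' = 1"
  shows "ok try_both s (\<lambda>t s'. \<exists>d. t \<le> (d + 1) * round_time \<and> env s' \<and> fst s' ''i'' = i \<and>
    (\<forall>a. snd s' ''M1'' a \<le> Suc i \<and> snd s' ''M2'' a \<le> Suc i) \<and> good s' \<and> chosen s \<subseteq> chosen s' \<and>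
    (fst s' ''ok'' = 1 \<and> (i \<in> chosen s' \<or> i + m \<in> chosen s') \<and> card (chosen s') = card (chosen s) + d \<or>
     fst s' ''ok'' = 0 \<and> d \<le> N \<and> (\<nexists>X. solves X)))"
proof -
  define s1 where "s1 = eff start_both s"
  note st = running_start[OF env i M, folded s1_def]
  have env1: "env s1" by (rule env_frame[OF env st(6)]) auto
  have ch1: "chosen s1 = chosen s" using chosen_frame[OF st(6)] by simp
  have Y1: "closed_under (chosen s1) (chosen s1)" using g ch1 by (simp add: good_def)
  let ?R = "regs ''1'' \<union> regs ''2''" and ?A = "{''M1'', ''q1'', ''M2'', ''q2''}"
  let ?T = "expand_time + 1 + bcost undecided"
  let ?C = "Cond (won ''1'') (commit ''1'') (Cond (won ''2'') (commit ''2'') (Assign ''ok'' (Const 0)))"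
  define Q where "Q d s' \<longleftrightarrow> env s' \<and> fst s' ''i'' = i \<and>
    (\<forall>a. snd s' ''M1'' a \<le> Suc i \<and> snd s' ''M2'' a \<le> Suc i) \<and> good s' \<and> chosen s \<subseteq> chosen s' \<and>
    (fst s' ''ok'' = 1 \<and> (i \<in> chosen s' \<or> i + m \<in> chosen s') \<and> card (chosen s') = card (chosen s) + d \<or>
     fst s' ''ok'' = 0 \<and> d \<le> N \<and> (\<nexists>X. solves X))" for d s'
  have final: "ok ?C s2 (\<lambda>t s'. t \<le> (r + 2) * (tm (commit_one ''1'') + tm (commit_one ''2'') + 8) +
       bcost (won ''1'') + bcost (won ''2'') + 4 \<and> Q r s')"
    if nb: "\<not> bval undecided s2" and rN: "r \<le> N"
      and r1: "running ''1'' i s2" and r2: "running ''2'' (ng i) s2"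
      and h: "fst s2 ''c1'' = 0 \<longrightarrow> fst s2 ''h1'' = r" "fst s2 ''c2'' = 0 \<longrightarrow> fst s2 ''h2'' = r"
      and fr: "frame ?R ?A s1 s2" for r s2
  proof -
    have env2: "env s2" by (rule env_frame[OF env1 fr]) (auto simp: regs_def)
    have ch2: "chosen s2 = chosen s" using chosen_frame[OF fr] ch1 by simp
    have g2: "good s2" using g ch2 by (simp add: good_def)
    have regs2: "fst s2 ''i'' = i" "fst s2 ''ok'' = 1" "fst s2 ''p'' = Suc i"
      using frame_simps(1)[OF fr] frame_simps(1)[OF st(6)] i flag st(3) by (simp_all add: regs_def)
    have M2: "snd s2 ''M1'' a \<le> Suc i \<and> snd s2 ''M2'' a \<le> Suc i" for a
      using r1 r2 regs2(3) unfolding running_def propagation_def by simp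
    have ngi: "ng i = i + m" using i by (simp add: ng_def)
    have commit: "ok (commit k) s2 (\<lambda>t s'. t \<le> (r + 2) * (tm (commit_one k) + 4) \<and> Q r s')"
      if "running k a s2" "bval (won k) s2" "fst s2 (CHR ''h'' # k) = r" "a = i \<or> a = i + m" for k a
    proof (rule ok_weaken[OF commit_won[OF that(1,2) g2]])
      fix t s' assume a: "t \<le> (fst s2 (CHR ''h'' # k) + 2) * (tm (commit_one k) + 4) \<and>
        frame {''j''} {''v''} s2 s' \<and> good s' \<and> a \<in> chosen s' \<and> chosen s2 \<subseteq> chosen s' \<and>
        card (chosen s') = card (chosen s2) + fst s2 (CHR ''h'' # k)"
      then have f: "frame {''j''} {''v''} s2 s'" by blast
      have "env s'" by (rule env_frame[OF env2 f]) auto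
      moreover have "fst s' ''i'' = i" "fst s' ''ok'' = 1" "snd s' ''M1'' = snd s2 ''M1''"
        "snd s' ''M2'' = snd s2 ''M2''"
        using frame_simps[OF f] regs2 by simp_all
      ultimately show "t \<le> (r + 2) * (tm (commit_one k) + 4) \<and> Q r s'"
        using a that(3,4) M2 ch2 unfolding Q_def by auto
    qed
    show ?thesis
    proof (rule ok_Cond)
      assume w: "bval (won ''1'') s2"
      show "ok (commit ''1'') s2 (\<lambda>t s'. 1 + bcost (won ''1'') + t \<le>
        (r + 2) * (tm (commit_one ''1'') + tm (commit_one ''2'') + 8) +
        bcost (won ''1'') + bcost (won ''2'') + 4 \<and> Q r s')"
        by (rule ok_weaken[OF commit[OF r1 w]]) (use w h in \<open>auto simp: won_def algebra_simps\<close>)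
    next
      assume nw: "\<not> bval (won ''1'') s2"
      show "ok (Cond (won ''2'') (commit ''2'') (Assign ''ok'' (Const 0))) s2
        (\<lambda>t s'. 1 + bcost (won ''1'') + t \<le>
        (r + 2) * (tm (commit_one ''1'') + tm (commit_one ''2'') + 8) +
        bcost (won ''1'') + bcost (won ''2'') + 4 \<and> Q r s')"
      proof (rule ok_Cond)
        assume w: "bval (won ''2'') s2"
        show "ok (commit ''2'') s2 (\<lambda>t s'. 1 + bcost (won ''1'') + (1 + bcost (won ''2'') + t) \<le>
          (r + 2) * (tm (commit_one ''1'') + tm (commit_one ''2'') + 8) +
          bcost (won ''1'') + bcost (won ''2'') + 4 \<and> Q r s')"
          by (rule ok_weaken[OF commit[OF r2 w]]) (use w h ngi in \<open>auto simp: won_def algebra_simps\<close>)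
      next
        assume nw2: "\<not> bval (won ''2'') s2"
        \<comment> \<open>The loop has ended without a winner, so both propagations carry a
          contradiction.\<close>
        have "fst s2 ''c1'' \<noteq> 0" "fst s2 ''c2'' \<noteq> 0"
          using nb nw nw2 by (auto simp: undecided_def)
        then have "\<not> consistent (implied i)" "\<not> consistent (implied (ng i))"
          using r1 r2 unfolding running_def propagation_def by auto
        then have uns: "\<nexists>X. solves X" using not_solvable[of i] i by simp
        let ?s' = "eff (Assign ''ok'' (Const 0)) s2"
        have f: "frame {''ok''} {} s2 ?s'" by (simp add: frame_def)
        have "env ?s'" by (rule env_frame[OF env2 f]) auto
        moreover have "chosen ?s' = chosen s" using chosen_frame[OF f] ch2 by simp
        ultimately have "Q r ?s'"
          using regs2 M2 g rN uns unfolding Q_def good_def by simp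
        then show "ok (Assign ''ok'' (Const 0)) s2
          (\<lambda>t s'. 1 + bcost (won ''1'') + (1 + bcost (won ''2'') + t) \<le>
          (r + 2) * (tm (commit_one ''1'') + tm (commit_one ''2'') + 8) +
          bcost (won ''1'') + bcost (won ''2'') + 4 \<and> Q r s')"
          by (intro ok_weaken[OF ok_loop_free]) auto
      qed
    qed
  qed
  have "ok try_both s (\<lambda>t s'. \<exists>d. t \<le> (d + 1) * round_time \<and> Q d s')"
    unfolding try_both_def
  proof (rule ok_block_Cons, rule ok_weaken[OF ok_loop_free[OF loop_free_parts(4)]], elim conjE)
    fix t0 s1' assume t0: "t0 \<le> tm start_both" and "s1' = eff start_both s"
    then have s1': "s1' = s1" by (simp add: s1_def)
    show "ok (block [While undecided (block [expand ''1'', expand ''2'']), ?C]) s1'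
      (\<lambda>t' s'. \<exists>d. t0 + t' \<le> (d + 1) * round_time \<and> Q d s')"
      unfolding s1'
    proof (rule ok_block_Cons, rule ok_weaken[OF ok_expands[OF env1 Y1 st(1,2,4,5)]], elim exE conjE)
      fix t1 s2 r
      assume t1: "t1 \<le> (r + 1) * ?T" and *: "\<not> bval undecided s2" "r \<le> N"
        "running ''1'' i s2" "running ''2'' (ng i) s2"
        "fst s2 ''c1'' = 0 \<longrightarrow> fst s2 ''h1'' = r" "fst s2 ''c2'' = 0 \<longrightarrow> fst s2 ''h2'' = r"
        "frame ?R ?A s1 s2"
      show "ok (block [?C]) s2 (\<lambda>t' s'. \<exists>d. t0 + (t1 + t') \<le> (d + 1) * round_time \<and> Q d s')"
      proof (rule ok_block_Cons, rule ok_weaken[OF final[OF *]], elim conjE)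
        fix t2 s3
        let ?D = "tm (commit_one ''1'') + tm (commit_one ''2'') + 8"
        assume t2: "t2 \<le> (r + 2) * ?D + bcost (won ''1'') + bcost (won ''2'') + 4" and Q: "Q r s3"
        define W where "W = bcost (won ''1'') + bcost (won ''2'')"
        have "(r + 2) * ?D \<le> (r + 1) * (2 * ?D)" by (simp add: algebra_simps)
        then have "t0 + (t1 + (t2 + 1)) \<le>
            tm start_both + ((r + 1) * ?T + ((r + 1) * (2 * ?D) + W + 5))"
          using t0 t1 t2 unfolding W_def by linarith
        also have "\<dots> \<le> (r + 1) * (tm start_both + ?T + 2 * ?D + W + 5)"
          by (simp add: algebra_simps)
        also have "\<dots> \<le> (r + 1) * round_time"
          by (rule mult_le_mono2) (simp add: round_time_def W_def)
        finally show "ok (block []) s3 (\<lambda>t' s'. \<exists>d. t0 + (t1 + (t2 + t')) \<le> (d + 1) * round_time \<and> Q d s')"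
          using Q by (intro ok_block_Nil) blast
      qed
    qed
  qed
  then show ?thesis unfolding Q_def .
qed

section \<open>Amortised analysis of the main loop\<close>

abbreviation deciding :: bexp where
  "deciding \<equiv> Conj (Less (Var ''i'') (Var ''m'')) (Equal (Var ''ok'') (Const 1))"

definition deciding_inv :: "state \<Rightarrow> bool" where
  "deciding_inv s \<longleftrightarrow> env s \<and> good s \<and> fst s ''i'' \<le> m \<and>
     (\<forall>a. snd s ''M1'' a \<le> fst s ''i'' \<and> snd s ''M2'' a \<le> fst s ''i'') \<and>
     (fst s ''ok'' = 1 \<and> (\<forall>k<fst s ''i''. k \<in> chosen s \<or> k + m \<in> chosen s) \<or>
      fst s ''ok'' = 0 \<and> (\<nexists>X. solves X))"

text \<open>The work of a round is charged to the literals that it commits; only the last round of a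
  failing run commits nothing, and \<open>N + 1\<close> is put aside for it.\<close>

definition potential :: "state \<Rightarrow> nat" where
  "potential s = ((m - fst s ''i'') + (N - card (chosen s)) + (if fst s ''ok'' = 1 then N + 1 else 0)) *
     decide_time"

lemma card_chosen: "card (chosen s) \<le> N"
  using card_mono[OF _ chosen_subset] by simp

text \<open>A round costs at most \<open>(d + 1) * decide_time\<close>. The step of \<open>i\<close>
  pays one share; the other \<open>d\<close> come from the committed literals or, on failure, from
  the reserve, which disappears when \<open>ok\<close> becomes 0.\<close>

lemma ok_decide_edge:
  assumes I: "deciding_inv s" and b: "bval deciding s"
  shows "ok decide_edge s (\<lambda>t s'. deciding_inv s' \<and> 1 + bcost deciding + t + potential s' \<le> potential s)"
proof -
  let ?c = "Conj (Equal (Read ''v'' (Var ''i'')) (Const 0))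
      (Equal (Read ''v'' (Add (Var ''i'') (Var ''m''))) (Const 0))"
  let ?inc = "Assign ''i'' (Add (Var ''i'') (Const 1))"
  let ?i = "fst s ''i''"
  have m: "fst s ''m'' = m" using I by (simp add: deciding_inv_def env_def data_def)
  have i: "?i < m" and flag: "fst s ''ok'' = 1" using b m by auto
  have c: "bval ?c s \<longleftrightarrow> ?i \<notin> chosen s \<and> ?i + m \<notin> chosen s"
    using i m by (simp add: chosen_def)
  define Q where "Q d s1 \<longleftrightarrow> env s1 \<and> fst s1 ''i'' = ?i \<and>
    (\<forall>a. snd s1 ''M1'' a \<le> Suc ?i \<and> snd s1 ''M2'' a \<le> Suc ?i) \<and> good s1 \<and> chosen s \<subseteq> chosen s1 \<and>
    (fst s1 ''ok'' = 1 \<and> (?i \<in> chosen s1 \<or> ?i + m \<in> chosen s1) \<and> card (chosen s1) = card (chosen s) + d \<or>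
     fst s1 ''ok'' = 0 \<and> d \<le> N \<and> (\<nexists>X. solves X))" for d s1
  \<comment> \<open>The 13 consists of 12 units for the conditional with its test and one for
    \<open>Skip\<close>.\<close>
  have first: "ok (Cond ?c try_both Skip) s (\<lambda>t s1. \<exists>d. t \<le> (d + 1) * round_time + 13 \<and> Q d s1)"
  proof (rule ok_Cond)
    assume "bval ?c s"
    then have nc: "?i \<notin> chosen s" "?i + m \<notin> chosen s" using c by auto
    have "ok try_both s (\<lambda>t s1. \<exists>d. t \<le> (d + 1) * round_time \<and> Q d s1)"
      unfolding Q_def
      by (rule ok_try_both[OF _ i refl nc _ _ _ flag]) (use I in \<open>auto simp: deciding_inv_def\<close>)
    then show "ok try_both s (\<lambda>t s1. \<exists>d. 1 + bcost ?c + t \<le> (d + 1) * round_time + 13 \<and> Q d s1)"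
    proof (rule ok_weaken, elim exE conjE)
      fix t s1 d assume "t \<le> (d + 1) * round_time" "Q d s1"
      then show "\<exists>d. 1 + bcost ?c + t \<le> (d + 1) * round_time + 13 \<and> Q d s1"
        by (intro exI[of _ d]) simp
    qed
  next
    assume "\<not> bval ?c s"
    \<comment> \<open>An edge already decided by an earlier round commits nothing, so
      \<open>d\<close> is 0.\<close>
    then have "Q 0 s" using c I flag unfolding Q_def deciding_inv_def by (auto intro: le_SucI)
    then show "ok Skip s (\<lambda>t s1. \<exists>d. 1 + bcost ?c + t \<le> (d + 1) * round_time + 13 \<and> Q d s1)"
      by (intro ok_Skip exI[of _ 0]) simp
  qed
  have step: "deciding_inv (eff ?inc s1) \<and>
      1 + bcost deciding + (t + (t' + 1)) + potential (eff ?inc s1) \<le> potential s"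
    if t: "t \<le> (d + 1) * round_time + 13" and t': "t' \<le> 4" and Q: "Q d s1" for t t' d s1
  proof
    let ?s' = "eff ?inc s1"
    have f: "frame {''i''} {} s1 ?s'" by (simp add: frame_def)
    have env': "env ?s'" by (rule env_frame[OF _ f]) (use Q in \<open>auto simp: Q_def\<close>)
    have ch: "chosen ?s' = chosen s1" using chosen_frame[OF f] by simp
    have i': "fst ?s' ''i'' = Suc ?i" "fst ?s' ''ok'' = fst s1 ''ok''" using Q by (simp_all add: Q_def)
    have old: "k \<in> chosen s1 \<or> k + m \<in> chosen s1" if "k < ?i" for k
      using that I Q flag unfolding deciding_inv_def Q_def by auto
    show "deciding_inv ?s'"
      using Q old env' i unfolding deciding_inv_def good_def ch i' Q_def
      by (auto simp: less_Suc_eq)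
    have T: "1 + bcost deciding + (t + (t' + 1)) \<le> (d + 1) * decide_time"
    proof -
      have "1 + bcost deciding + (t + (t' + 1)) \<le> (d + 1) * round_time + 26"
        using t t' by simp
      also have "\<dots> \<le> (d + 1) * decide_time" by (simp add: decide_time_def algebra_simps)
      finally show ?thesis .
    qed
    have "(d + 1) + ((m - fst ?s' ''i'') + (N - card (chosen ?s')) + (if fst ?s' ''ok'' = 1 then N + 1 else 0))
      \<le> (m - ?i) + (N - card (chosen s)) + (if fst s ''ok'' = 1 then N + 1 else 0)"
    proof -
      have "finite (chosen s1)" "chosen s \<subseteq> chosen s1"
        using Q finite_subset[OF chosen_subset] unfolding Q_def by blast+
      then have "card (chosen s) \<le> card (chosen s1)" "card (chosen s1) \<le> N"
        using card_chosen by (auto intro: card_mono)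
      then show ?thesis using Q i flag unfolding ch i' Q_def by auto
    qed
    then have "(d + 1) * decide_time + potential ?s' \<le> potential s"
      unfolding potential_def by (metis add_mult_distrib mult_le_mono1)
    with T show "1 + bcost deciding + (t + (t' + 1)) + potential ?s' \<le> potential s" by linarith
  qed
  show ?thesis unfolding decide_edge_def
  proof (rule ok_block_Cons, rule ok_weaken[OF first], elim exE conjE)
    fix t s1 d assume *: "t \<le> (d + 1) * round_time + 13" "Q d s1"
    show "ok (block [?inc]) s1 (\<lambda>t' s'. deciding_inv s' \<and>
      1 + bcost deciding + (t + t') + potential s' \<le> potential s)"
    proof (rule ok_block_Cons, rule ok_weaken[OF ok_loop_free], simp, elim conjE)
      fix t' s' assume "t' \<le> tm ?inc" "s' = eff ?inc s1"
      then show "ok (block []) s' (\<lambda>t'' s'. deciding_inv s' \<and>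
          1 + bcost deciding + (t + (t' + t'')) + potential s' \<le> potential s)"
        using step[OF *(1) _ *(2), of t'] by (intro ok_block_Nil) simp
    qed
  qed
qed

lemma solves_chosen:
  assumes "deciding_inv s" "\<not> bval deciding s"
  shows "fst s ''ok'' = 1 \<and> solves (chosen s) \<or> fst s ''ok'' = 0 \<and> (\<nexists>X. solves X)"
proof (cases "fst s ''ok'' = 1")
  case True
  then have "fst s ''i'' = m" using assms by (auto simp: deciding_inv_def env_def data_def)
  then have all: "k \<in> chosen s \<or> k + m \<in> chosen s" if "k < m" for k
    using that assms(1) True unfolding deciding_inv_def by auto
  have "solves (chosen s)"
  proof (rule solves_total[OF chosen_subset])
    fix l assume "l < N"
    then show "l \<in> chosen s \<or> ng l \<in> chosen s"
      using all[of l] all[of "l - m"] by (cases "l < m") (auto simp: ng_def)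
  qed (use assms(1) in \<open>auto simp: deciding_inv_def good_def\<close>)
  then show ?thesis using True by simp
qed (use assms in \<open>auto simp: deciding_inv_def\<close>)

section \<open>Writing the bends, and the complete run\<close>

definition bends_set :: "nat \<Rightarrow> nat set \<Rightarrow> state \<Rightarrow> bool" where
  "bends_set r X s \<longleftrightarrow> (\<forall>k<r. snd s ''bend'' k = 1 \<and>
     snd s ''bx'' k = x (va (if k \<in> X then k else k + m)) \<and>
     snd s ''by'' k = y (ho (if k \<in> X then k else k + m)))"

lemma ok_set_bends:
  assumes "env s" "fst s ''i'' = 0"
  shows "ok (While (Less (Var ''i'') (Var ''m'')) set_bend) s
    (\<lambda>t s'. t \<le> (m + 1) * (tm set_bend + 4) \<and> bends_set m (chosen s) s' \<and>
      frame {''i'', ''l''} {''bend'', ''bx'', ''by''} s s')"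
proof -
  let ?R = "{''i'', ''l''}" and ?A = "{''bend'', ''bx'', ''by''}"
  let ?b = "Less (Var ''i'') (Var ''m'')"
  define I where "I r s' \<longleftrightarrow> r \<le> m \<and> fst s' ''i'' = r \<and> frame ?R ?A s s' \<and>
    bends_set r (chosen s) s'" for r and s' :: state
  have m: "fst s' ''m'' = m" if "frame ?R ?A s s'" for s'
    using assms(1) frame_simps(1)[OF that] by (simp add: env_def data_def)
  have step: "r < m \<and> ok set_bend s0 (\<lambda>t s'. t \<le> tm set_bend \<and> I (Suc r) s')"
    if I: "I r s0" and b: "bval ?b s0" for r s0
  proof
    have fr: "frame ?R ?A s s0" using I by (simp add: I_def)
    show r: "r < m" using I b m[OF fr] by (simp add: I_def)
    have env0: "env s0" by (rule env_frame[OF assms(1) fr]) auto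
    define l where "l = (if r \<in> chosen s then r else r + m)"
    have "l < N" using r by (simp add: l_def)
    then have e: "snd s0 ''va'' l = va l" "snd s0 ''ho'' l = ho l" "snd s0 ''x'' = x" "snd s0 ''y'' = y"
      using env0 by (simp_all add: env_def ends_set_def data_def)
    have v: "snd s0 ''v'' r = 0 \<longleftrightarrow> r \<notin> chosen s"
    proof -
      have "r \<in> chosen s0 \<longleftrightarrow> snd s0 ''v'' r \<noteq> 0" using r by (simp add: chosen_def)
      then show ?thesis using chosen_frame[OF fr] by simp
    qed
    let ?s' = "eff set_bend s0"
    have s': "?s' = ((fst s0)(''l'' := l, ''i'' := Suc r),
      (snd s0)(''bend'' := (snd s0 ''bend'')(r := 1), ''bx'' := (snd s0 ''bx'')(r := x (va l)),
        ''by'' := (snd s0 ''by'')(r := y (ho l))))"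
      using I v e m[OF fr] by (cases "r \<in> chosen s") (simp_all add: set_bend_def I_def l_def)
    have "frame ?R ?A s0 ?s'" unfolding s' by (simp add: frame_def)
    moreover have "bends_set (Suc r) (chosen s) ?s'"
      using I unfolding s' I_def bends_set_def by (auto simp: less_Suc_eq l_def)
    ultimately have "I (Suc r) ?s'"
      using r frame_trans[OF fr] unfolding I_def by (simp add: s')
    then show "ok set_bend s0 (\<lambda>t s'. t \<le> tm set_bend \<and> I (Suc r) s')"
      by (auto intro: ok_weaken[OF ok_loop_free[OF loop_free_parts(6)]])
  qed
  have I0: "I 0 s" using assms by (simp add: I_def frame_refl bends_set_def)
  show ?thesis
  proof (rule ok_weaken[OF ok_While_count[OF I0 step]], assumption, assumption, elim exE conjE)
    fix t s' r assume *: "I r s'" "\<not> bval ?b s'"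
      "t \<le> (r - 0) * (tm set_bend + 1 + bcost ?b) + 1 + bcost ?b"
    then have "r = m" using m[of s'] by (simp add: I_def)
    with * show "t \<le> (m + 1) * (tm set_bend + 4) \<and> bends_set m (chosen s) s' \<and> frame ?R ?A s s'"
      by (simp add: I_def algebra_simps)
  qed
qed

lemma ok_program:
  assumes data: "data s" and ends: "snd s ''src'' = sr" "snd s ''dst'' = ds"
    and zero: "fst s ''i'' = 0" "\<And>a i. a \<notin> {''x'', ''y'', ''src'', ''dst''} \<Longrightarrow> snd s a i = 0"
  shows "ok program s (\<lambda>t s'. t \<le> (m + 1) * total_time \<and>
    (fst s' ''ans'' = 1 \<and> (\<exists>X. solves X \<and> bends_set m X s') \<or> fst s' ''ans'' = 0 \<and> (\<nexists>X. solves X)))"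
proof -
  let ?zero = "Assign ''i'' (Const 0)"
  let ?b = "Less (Var ''i'') (Var ''m'')" and ?b2 = "Less (Var ''i'') (Add (Var ''m'') (Var ''m''))"
  let ?R1 = "{''i''}" and ?A1 = "{''va'', ''ho'', ''g''}"
  let ?R2 = "{''i'', ''s''}" and ?A2 = "{''A'', ''B'', ''O0'', ''O1'', ''O2'', ''O3''}"
  let ?R4 = "{''i'', ''l''}" and ?A4 = "{''bend'', ''bx'', ''by''}"
  let ?init = "block [?zero, Assign ''ok'' (Const 1)]"
  let ?res = "\<lambda>s'. fst s' ''ans'' = 1 \<and> (\<exists>X. solves X \<and> bends_set m X s') \<or>
    fst s' ''ans'' = 0 \<and> (\<nexists>X. solves X)"
  have D: "ok (block [?zero, While ?b set_bend, Assign ''ans'' (Var ''ok'')]) s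
      (\<lambda>t s'. t \<le> (m + 1) * (tm set_bend + 4) + 5 \<and> ?res s')"
    if I: "deciding_inv s" and nb: "\<not> bval deciding s" for s
  proof (rule ok_block_Cons, rule ok_weaken[OF ok_loop_free], simp, elim conjE)
    fix t1 s1 assume t1: "t1 \<le> tm ?zero" and s1: "s1 = eff ?zero s"
    then have f1: "frame {''i''} {} s s1" by (simp add: frame_def)
    have env1: "env s1" by (rule env_frame[OF _ f1]) (use I in \<open>auto simp: deciding_inv_def\<close>)
    have i1: "fst s1 ''i'' = 0" by (simp add: s1)
    show "ok (block [While ?b set_bend, Assign ''ans'' (Var ''ok'')]) s1
      (\<lambda>t s'. t1 + t \<le> (m + 1) * (tm set_bend + 4) + 5 \<and> ?res s')"
    proof (rule ok_block_Cons, rule ok_weaken[OF ok_set_bends[OF env1 i1]], elim conjE)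
      fix t2 s2 assume t2: "t2 \<le> (m + 1) * (tm set_bend + 4)"
        and bs: "bends_set m (chosen s1) s2" and f2: "frame ?R4 ?A4 s1 s2"
      have ok2: "fst s2 ''ok'' = fst s ''ok''"
        using frame_simps(1)[OF f2] frame_simps(1)[OF f1] by simp
      have ch: "chosen s1 = chosen s" using chosen_frame[OF f1] by simp
      show "ok (block [Assign ''ans'' (Var ''ok'')]) s2
        (\<lambda>t s'. t1 + (t2 + t) \<le> (m + 1) * (tm set_bend + 4) + 5 \<and> ?res s')"
      proof (rule ok_block_Cons, rule ok_weaken[OF ok_loop_free], simp, elim conjE)
        fix t3 s3 assume t3: "t3 \<le> tm (Assign ''ans'' (Var ''ok''))"
          and s3: "s3 = eff (Assign ''ans'' (Var ''ok'')) s2"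
        have "bends_set m (chosen s) s3" "fst s3 ''ans'' = fst s ''ok''"
          using bs ch ok2 by (simp_all add: s3 bends_set_def)
        then have "?res s3" using solves_chosen[OF I nb] by auto
        then show "ok (block []) s3 (\<lambda>t s'. t1 + (t2 + (t3 + t)) \<le> (m + 1) * (tm set_bend + 4) + 5 \<and> ?res s')"
          using t1 t2 t3 by (intro ok_block_Nil) simp
      qed
    qed
  qed
  show ?thesis unfolding program_def
  proof (rule ok_block_Cons, rule ok_weaken[OF ok_set_ends[OF data zero(1) ends]], elim conjE)
    fix t1 s1 assume t1: "t1 \<le> (m + 1) * (tm set_ends + 4)" and d1: "data s1" "ends_set s1"
      and f1: "frame ?R1 ?A1 s s1"
    have z1: "snd s1 a i = 0"
      if "a \<in> {''A'', ''B'', ''O0'', ''O1'', ''O2'', ''O3'', ''v'', ''M1'', ''M2''}" for a i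
      using that frame_simps(2)[OF f1, of a] zero(2)[of a i] by auto
    show "ok (block [?zero, While ?b2 set_slots, ?init, While deciding decide_edge, ?zero,
        While ?b set_bend, Assign ''ans'' (Var ''ok'')]) s1
      (\<lambda>t s'. t1 + t \<le> (m + 1) * total_time \<and> ?res s')"
    proof (rule ok_block_Cons, rule ok_weaken[OF ok_loop_free], simp, elim conjE)
      fix t2 s2 assume t2: "t2 \<le> tm ?zero" and s2: "s2 = eff ?zero s1"
      then have f2: "frame ?R1 {} s1 s2" by (simp add: frame_def)
      have d2: "data s2" by (rule data_frame[OF d1(1) f2]) auto
      have e2: "ends_set s2" by (rule ends_set_frame[OF d1(2) f2]) auto
      have sl2: "slots_set 0 s2" using z1 by (simp add: slots_set_def s2 users_def entry_def)
      have i2: "fst s2 ''i'' = 0" by (simp add: s2)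
      show "ok (block [While ?b2 set_slots, ?init, While deciding decide_edge, ?zero,
          While ?b set_bend, Assign ''ans'' (Var ''ok'')]) s2
        (\<lambda>t s'. t1 + (t2 + t) \<le> (m + 1) * total_time \<and> ?res s')"
      proof (rule ok_block_Cons, rule ok_weaken[OF ok_set_slots[OF d2 e2 sl2 i2]], elim conjE)
        fix t3 s3 assume t3: "t3 \<le> (N + 1) * (tm set_slots + 6)"
          and d3: "data s3" "ends_set s3" "slots_set N s3" and f3: "frame ?R2 ?A2 s2 s3"
        have z3: "snd s3 ''v'' i = 0" "snd s3 ''M1'' i = 0" "snd s3 ''M2'' i = 0" for i
          using z1 frame_simps(2)[OF f3] by (simp_all add: s2)
        show "ok (block [?init, While deciding decide_edge, ?zero,
            While ?b set_bend, Assign ''ans'' (Var ''ok'')]) s3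
          (\<lambda>t s'. t1 + (t2 + (t3 + t)) \<le> (m + 1) * total_time \<and> ?res s')"
        proof (rule ok_block_Cons, rule ok_weaken[OF ok_loop_free], simp, elim conjE)
          fix t4 s4 assume t4: "t4 \<le> tm ?init" and s4: "s4 = eff ?init s3"
          then have f4: "frame {''i'', ''ok''} {} s3 s4" by (simp add: frame_def)
          have "env s3" using d3 by (simp add: env_def)
          then have env4: "env s4" by (rule env_frame[OF _ f4]) auto
          have ch4: "chosen s4 = {}" using z3 by (simp add: chosen_def s4)
          have I4: "deciding_inv s4"
            using env4 ch4 z3
            by (simp add: deciding_inv_def good_def closed_under_def consistent_def s4)
          have pot: "potential s4 = (m + N + (N + 1)) * decide_time"
            using ch4 by (simp add: potential_def s4)
          show "ok (block [While deciding decide_edge, ?zero,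
              While ?b set_bend, Assign ''ans'' (Var ''ok'')]) s4
            (\<lambda>t s'. t1 + (t2 + (t3 + (t4 + t))) \<le> (m + 1) * total_time \<and> ?res s')"
          proof (rule ok_block_Cons,
              rule ok_weaken[OF ok_While_potential[of deciding_inv s4 deciding decide_edge potential]])
            fix t5 s5
            assume *: "deciding_inv s5 \<and> \<not> bval deciding s5 \<and> t5 \<le> potential s4 + 1 + bcost deciding"
            show "ok (block [?zero, While ?b set_bend, Assign ''ans'' (Var ''ok'')]) s5
              (\<lambda>t s'. t1 + (t2 + (t3 + (t4 + (t5 + t)))) \<le> (m + 1) * total_time \<and> ?res s')"
            proof (rule ok_weaken[OF D])
              fix t6 s6 assume **: "t6 \<le> (m + 1) * (tm set_bend + 4) + 5 \<and> ?res s6"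
              have t5: "t5 \<le> (m + 1) * (5 * decide_time) + 20"
                using * by (simp add: pot algebra_simps)
              have t3': "t3 \<le> (m + 1) * (2 * tm set_slots + 12)"
                using t3 by (simp add: algebra_simps)
              have t24: "t2 + t4 \<le> 10" using t2 t4 by (simp add: block_def)
              have "(m + 1) * (tm set_ends + 4) + 10 + (m + 1) * (2 * tm set_slots + 12) +
                  ((m + 1) * (5 * decide_time) + 20) + ((m + 1) * (tm set_bend + 4) + 5)
                \<le> (m + 1) * total_time"
                by (simp add: total_time_def algebra_simps)
              then show "t1 + (t2 + (t3 + (t4 + (t5 + t6)))) \<le> (m + 1) * total_time \<and> ?res s6"
                using t1 t24 t3' t5 ** by (intro conjI) (linarith, blast)
            qed (use * in auto)
          qed (use I4 ok_decide_edge in auto)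
        qed
      qed
    qed
  qed
qed

end

section \<open>Drawings and 2-satisfiability\<close>

text \<open>Vertices and edges are represented by their positions in \<open>vs\<close> and
  \<open>es\<close>, the only names that the program has for them.\<close>

locale drawing_instance =
  fixes V :: "'v set" and E :: "'v set set" and S :: "(nat \<times> nat) set" and \<mu> :: "'v \<Rightarrow> nat \<times> nat"
    and vs :: "'v list" and es :: "(nat \<times> nat) list"
  assumes graph: "simple_graph V E"
    and degree: "\<And>v. v \<in> V \<Longrightarrow> vertex_degree E v \<le> 4"
    and grid: "grid_point_set (card V) S"
    and bij: "bij_betw \<mu> V S"
    and enc: "graph_encoding V E vs es"
begin

abbreviation n :: nat where "n \<equiv> length vs"
abbreviation m :: nat where "m \<equiv> length es"
abbreviation x :: "nat \<Rightarrow> nat" where "x \<equiv> array_of (map (fst \<circ> \<mu>) vs)"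
abbreviation y :: "nat \<Rightarrow> nat" where "y \<equiv> array_of (map (snd \<circ> \<mu>) vs)"
abbreviation sr :: "nat \<Rightarrow> nat" where "sr \<equiv> array_of (map fst es)"
abbreviation ds :: "nat \<Rightarrow> nat" where "ds \<equiv> array_of (map snd es)"
abbreviation edge :: "nat \<Rightarrow> 'v set" where "edge k \<equiv> decode_edge vs (es ! k)"

lemma n_card: "n = card V"
  using enc by (auto simp: graph_encoding_def distinct_card)

lemma vertices: "u < n \<Longrightarrow> vs ! u \<in> V" "set vs = V" "distinct vs"
  using enc by (auto simp: graph_encoding_def)

lemma sr_ds: "k < m \<Longrightarrow> sr k = fst (es ! k)" "k < m \<Longrightarrow> ds k = snd (es ! k)"
  by (simp_all add: array_of_def)

lemma edge_eq: "k < m \<Longrightarrow> edge k = {vs ! sr k, vs ! ds k}"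
  by (simp add: decode_edge_def sr_ds)

lemma edges: "E = edge ` {..<m}"
proof -
  have "E = decode_edge vs ` set es" using enc by (simp add: graph_encoding_def)
  also have "set es = (!) es ` {..<m}" by (auto simp: set_conv_nth)
  finally show ?thesis by (simp add: image_image)
qed

lemma edge_inj: "inj_on edge {..<m}"
proof (rule inj_onI)
  fix i j assume "i \<in> {..<m}" "j \<in> {..<m}" "edge i = edge j"
  moreover have "distinct (map (decode_edge vs) es)" using enc by (simp add: graph_encoding_def)
  ultimately show "i = j" by (simp add: distinct_conv_nth) blast
qed

lemma ends_less: "k < m \<Longrightarrow> sr k < n" "k < m \<Longrightarrow> ds k < n"
proof -
  have "\<forall>(i, j) \<in> set es. i < n \<and> j < n" using enc by (simp add: graph_encoding_def)
  then show "k < m \<Longrightarrow> sr k < n" "k < m \<Longrightarrow> ds k < n"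
    using nth_mem[of k es] by (fastforce simp: sr_ds)+
qed

lemma ends_neq: "k < m \<Longrightarrow> sr k \<noteq> ds k"
proof
  assume k: "k < m" and eq: "sr k = ds k"
  have "card (edge k) = 2" using graph edges k by (auto simp: simple_graph_def)
  then show False using edge_eq[OF k] eq by simp
qed

lemma edge_index_card:
  assumes "u < n"
  shows "card {k. k < m \<and> (sr k = u \<or> ds k = u)} \<le> 4"
proof -
  let ?K = "{k. k < m \<and> (sr k = u \<or> ds k = u)}"
  have "finite {e \<in> E. vs ! u \<in> e}" using edges by simp
  moreover have "inj_on edge ?K" by (rule inj_on_subset[OF edge_inj]) auto
  moreover have "edge ` ?K \<subseteq> {e \<in> E. vs ! u \<in> e}" using edges edge_eq by auto
  ultimately have "card ?K \<le> vertex_degree E (vs ! u)"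
    unfolding vertex_degree_def using card_inj_on_le by blast
  also have "\<dots> \<le> 4" by (rule degree) (rule vertices(1)[OF assms])
  finally show ?thesis .
qed

sublocale grid_instance n m x y sr ds
  by unfold_locales (fact ends_less ends_neq edge_index_card)+

lemma coords: "u < n \<Longrightarrow> x u = fst (\<mu> (vs ! u))" "u < n \<Longrightarrow> y u = snd (\<mu> (vs ! u))"
  by (simp_all add: array_of_def)

lemma coords_inj:
  assumes "u < n" "v < n" "u \<noteq> v"
  shows "x u \<noteq> x v" "y u \<noteq> y v"
proof -
  have "vs ! u \<noteq> vs ! v" using assms vertices(3) by (simp add: nth_eq_iff_index_eq)
  then have "\<mu> (vs ! u) \<noteq> \<mu> (vs ! v)"
    using bij assms vertices(1) by (metis bij_betw_imp_inj_on inj_onD)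
  moreover have "\<mu> (vs ! u) \<in> S" "\<mu> (vs ! v) \<in> S"
    using bij assms vertices(1) by (auto simp: bij_betw_def)
  ultimately show "x u \<noteq> x v" "y u \<noteq> y v"
    using grid assms by (auto simp: grid_point_set_def coords)
qed

text \<open>Double counting of incidences: every edge has two ends and every vertex at most four
  edges. This turns the bounds in \<open>m\<close> into bounds in \<open>n\<close>.\<close>

lemma edge_count: "m \<le> 2 * n"
proof -
  let ?K = "\<lambda>u. {k. k < m \<and> (sr k = u \<or> ds k = u)}"
  have "2 * m = (\<Sum>k<m. card {u. u < n \<and> (sr k = u \<or> ds k = u)})"
  proof -
    have "card {u. u < n \<and> (sr k = u \<or> ds k = u)} = 2" if "k < m" for k
    proof -
      have "{u. u < n \<and> (sr k = u \<or> ds k = u)} = {sr k, ds k}"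
        using ends_less that by auto
      then show ?thesis using ends_neq[OF that] by simp
    qed
    then show ?thesis by simp
  qed
  also have "\<dots> = (\<Sum>k<m. \<Sum>u<n. if sr k = u \<or> ds k = u then 1 else 0)"
    by (intro sum.cong refl) (simp add: sum.If_cases lessThan_def Int_def)
  also have "\<dots> = (\<Sum>u<n. \<Sum>k<m. if sr k = u \<or> ds k = u then 1 else 0)"
    by (rule sum.swap)
  also have "\<dots> = (\<Sum>u<n. card (?K u))"
    by (intro sum.cong refl) (simp add: sum.If_cases lessThan_def Int_def)
  also have "\<dots> \<le> (\<Sum>u<n. 4)" using deg by (intro sum_mono) simp
  finally show ?thesis by simp
qed

section \<open>Geometry of L-shaped edges\<close>

definition pos :: "nat \<Rightarrow> point" where
  "pos u = (real (x u), real (y u))"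

definition corner :: "nat \<Rightarrow> point" where
  "corner l = (real (x (va l)), real (y (ho l)))"

text \<open>Both orders occur, since an edge is an unordered pair and its chain may start at either
  end.\<close>

definition draws :: "nat \<Rightarrow> point list \<Rightarrow> bool" where
  "draws l ps \<longleftrightarrow> ps = [pos (va l), corner l, pos (ho l)] \<or> ps = [pos (ho l), corner l, pos (va l)]"

definition vseg :: "nat \<Rightarrow> point set" where
  "vseg l = closed_segment (pos (va l)) (corner l)"

definition hseg :: "nat \<Rightarrow> point set" where
  "hseg l = closed_segment (corner l) (pos (ho l))"

lemma pt_pos: "u < n \<Longrightarrow> pt (\<mu> (vs ! u)) = pos u"
  by (simp add: pt_def pos_def coords)

lemma vseg_eq: "vseg l = {real (x (va l))} \<times> closed_segment (real (y (va l))) (real (y (ho l)))"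
  unfolding vseg_def by (subst closed_segment_same_fst) (simp_all add: pos_def corner_def)

lemma hseg_eq: "hseg l = closed_segment (real (x (va l))) (real (x (ho l))) \<times> {real (y (ho l))}"
  unfolding hseg_def by (subst closed_segment_same_snd) (simp_all add: pos_def corner_def)

lemma draws_image: "draws l ps \<Longrightarrow> chain_image ps = vseg l \<union> hseg l"
  unfolding draws_def chain_image_def segments_def vseg_def hseg_def
  by (elim disjE) (simp_all add: closed_segment_commute Un_commute)

lemma draws_segment:
  assumes "draws l ps" "(a, b) \<in> set (segments ps)"
  shows "closed_segment a b = vseg l \<and> fst (b - a) = 0 \<or> closed_segment a b = hseg l \<and> snd (b - a) = 0"
proof -
  have "(a, b) \<in> {(pos (va l), corner l), (corner l, pos (ho l)),
      (pos (ho l), corner l), (corner l, pos (va l))}"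
    using assms by (auto simp: draws_def segments_def)
  then consider "{a, b} = {pos (va l), corner l}" | "{a, b} = {corner l, pos (ho l)}" by blast
  then show ?thesis
  proof cases
    case 1
    then have "closed_segment a b = vseg l" "fst a = fst b"
      by (auto simp: doubleton_eq_iff vseg_def closed_segment_commute pos_def corner_def)
    then show ?thesis by simp
  next
    case 2
    then have "closed_segment a b = hseg l" "snd a = snd b"
      by (auto simp: doubleton_eq_iff hseg_def closed_segment_commute pos_def corner_def)
    then show ?thesis by simp
  qed
qed

text \<open>Vertical segments meet only in a common column, and a column has a single vertex, so
  both start there. With different slots they leave it in opposite directions.\<close>

lemma vseg_meet:
  assumes "a < N" "b < N" "a \<noteq> b" "\<not> cf a b" "p \<in> vseg a" "p \<in> vseg b"
  shows "va a = va b" "p = pos (va a)"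
proof -
  have "x (va a) = x (va b)" using assms(5,6) by (auto simp: vseg_eq)
  then show eq: "va a = va b" using coords_inj(1) va_ho(1) assms(1,2) by blast
  have "vslot a \<noteq> vslot b" using assms(1-4) by (simp add: cf_def)
  then show "p = pos (va a)"
    using assms(5,6) eq
    by (auto simp: vslot_def vseg_eq pos_def closed_segment_eq_real_ivl split: if_splits)
qed

lemma hseg_meet:
  assumes "a < N" "b < N" "a \<noteq> b" "\<not> cf a b" "p \<in> hseg a" "p \<in> hseg b"
  shows "ho a = ho b" "p = pos (ho a)"
proof -
  have "y (ho a) = y (ho b)" using assms(5,6) by (auto simp: hseg_eq)
  then show eq: "ho a = ho b" using coords_inj(2) va_ho(2) assms(1,2) by blast
  have "hslot a \<noteq> hslot b" using assms(1-4) by (simp add: cf_def)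
  then show "p = pos (ho a)"
    using assms(5,6) eq
    by (auto simp: hslot_def hseg_eq pos_def closed_segment_eq_real_ivl split: if_splits)
qed

lemma edge_lit: "k < m \<Longrightarrow> l = k \<or> l = k + m \<Longrightarrow> edge k = {vs ! va l, vs ! ho l}"
  by (elim disjE) (simp_all add: edge_eq va_def ho_def insert_commute)

text \<open>Literals in the same slot leave a common vertex in the same direction. Coordinates are
  distinct integers, so both segments have length at least one and share a segment of length
  one.\<close>

lemma overlap_if_cf:
  assumes "cf a b" "draws a ps" "draws b qs"
  shows "overlap ps qs"
proof -
  have l: "a < N" "b < N" using assms(1) by (auto simp: cf_def)
  note ne = coords_inj[OF va_ho(1,2,3)[OF l(1)]] coords_inj[OF va_ho(1,2,3)[OF l(2)]]
  have "\<exists>c d. c \<noteq> d \<and> closed_segment c d \<subseteq> (vseg a \<union> hseg a) \<inter> (vseg b \<union> hseg b)"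
  proof (cases "vslot a = vslot b")
    case True
    define u where "u = va a"
    have u: "va a = u" "va b = u" using vslot_eq[OF l True] by (simp_all add: u_def)
    define d where "d = (if y u < y (ho a) then real (y u) + 1 else real (y u) - 1)"
    have dir: "y u < y (ho a) \<longleftrightarrow> y u < y (ho b)"
      using True u va_ho(1)[OF l(1)] by (auto simp: vslot_def split: if_splits)
    have "closed_segment (real (x u), real (y u)) (real (x u), d) =
        {real (x u)} \<times> closed_segment (real (y u)) d"
      by (subst closed_segment_same_fst) auto
    moreover have "closed_segment (real (y u)) d \<subseteq> closed_segment (real (y u)) (real (y (ho a)))"
      "closed_segment (real (y u)) d \<subseteq> closed_segment (real (y u)) (real (y (ho b)))"
      using dir ne u unfolding d_def closed_segment_eq_real_ivl by auto
    ultimately have "closed_segment (real (x u), real (y u)) (real (x u), d) \<subseteq> vseg a \<inter> vseg b"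
      unfolding vseg_eq u by auto
    moreover have "(real (x u), real (y u)) \<noteq> (real (x u), d)" by (simp add: d_def)
    ultimately show ?thesis by blast
  next
    case False
    then have h: "hslot a = hslot b" using assms(1) by (simp add: cf_def)
    define u where "u = ho a"
    have u: "ho a = u" "ho b = u" using hslot_eq[OF l h] by (simp_all add: u_def)
    define d where "d = (if x u < x (va a) then real (x u) + 1 else real (x u) - 1)"
    have dir: "x u < x (va a) \<longleftrightarrow> x u < x (va b)"
      using h u va_ho(2)[OF l(1)] by (auto simp: hslot_def split: if_splits)
    have "closed_segment (real (x u), real (y u)) (d, real (y u)) =
        closed_segment (real (x u)) d \<times> {real (y u)}"
      by (subst closed_segment_same_snd) auto
    moreover have "closed_segment (real (x u)) d \<subseteq> closed_segment (real (x (va a))) (real (x u))"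
      "closed_segment (real (x u)) d \<subseteq> closed_segment (real (x (va b))) (real (x u))"
      using dir ne u unfolding d_def closed_segment_eq_real_ivl by auto
    ultimately have "closed_segment (real (x u), real (y u)) (d, real (y u)) \<subseteq> hseg a \<inter> hseg b"
      unfolding hseg_eq u by auto
    moreover have "(real (x u), real (y u)) \<noteq> (d, real (y u))" by (simp add: d_def)
    ultimately show ?thesis by blast
  qed
  then show ?thesis
    unfolding overlap_def draws_image[OF assms(2)] draws_image[OF assms(3)] .
qed

text \<open>A vertical and a horizontal segment share at most one point, and so do parallel ones
  without conflict. The images meet in a finite set, but a nondegenerate segment is
  uncountable.\<close>

lemma no_overlap:
  assumes l: "a < N" "b < N" "a \<noteq> b" "\<not> cf a b" and "draws a ps" "draws b qs"
  shows "\<not> overlap ps qs"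
proof -
  have vh: "vseg c \<inter> hseg d \<subseteq> {(real (x (va c)), real (y (ho d)))}" for c d
    by (auto simp: vseg_eq hseg_eq)
  have "vseg a \<inter> vseg b \<subseteq> {pos (va a)}" "hseg a \<inter> hseg b \<subseteq> {pos (ho a)}"
    using vseg_meet[OF l] hseg_meet[OF l] by blast+
  with vh[of a b] vh[of b a] have "(vseg a \<union> hseg a) \<inter> (vseg b \<union> hseg b) \<subseteq>
    {pos (va a), pos (ho a), (real (x (va a)), real (y (ho b))), (real (x (va b)), real (y (ho a)))}"
    by blast
  then have fin: "finite ((vseg a \<union> hseg a) \<inter> (vseg b \<union> hseg b))"
    by (rule finite_subset) simp
  show ?thesis
  proof
    assume "overlap ps qs"
    then obtain c d where cd: "c \<noteq> d"
      "closed_segment c d \<subseteq> (vseg a \<union> hseg a) \<inter> (vseg b \<union> hseg b)"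
      unfolding overlap_def draws_image[OF assms(5)] draws_image[OF assms(6)] by blast
    have "countable (closed_segment c d)"
      by (rule countable_finite[OF finite_subset[OF cd(2) fin]])
    with uncountable_closed_segment[OF cd(1)] show False by blast
  qed
qed

section \<open>Solutions of the clauses against embeddings\<close>

definition lit_of :: "nat set \<Rightarrow> nat \<Rightarrow> nat" where
  "lit_of X k = (if k \<in> X then k else k + m)"

lemma lit_of_solution:
  assumes "solves X" "k < m"
  shows "lit_of X k \<in> X" "lit_of X k < N" "lit_of X k = k \<or> lit_of X k = k + m"
proof -
  have "ng k \<in> X \<longleftrightarrow> k \<notin> X" using assms by (simp add: solves_def)
  then show "lit_of X k \<in> X" using assms(2) by (auto simp: lit_of_def ng_def)
  show "lit_of X k < N" "lit_of X k = k \<or> lit_of X k = k + m"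
    using assms(2) by (auto simp: lit_of_def)
qed

text \<open>Right angles and the absence of overlaps both rest on \<open>vseg_meet\<close> and
  \<open>hseg_meet\<close>. Bends are integral since a corner takes its two coordinates from
  vertices.\<close>

lemma embedding_if_draws:
  assumes X: "solves X" and D: "\<And>k. k < m \<Longrightarrow> draws (lit_of X k) (D (edge k))"
  shows "restricted_RAC1_embedding V E S \<mu> D"
proof -
  let ?l = "lit_of X"
  note L = lit_of_solution[OF X]
  have ne: "?l i \<noteq> ?l j" if "i < m" "j < m" "i \<noteq> j" for i j
    using that by (auto simp: lit_of_def)
  have ncf: "\<not> cf (?l i) (?l j)" if "i < m" "j < m" for i j
    using X L(1) that unfolding solves_def by blast
  have chain: "polygonal_chain (D (edge k)) \<and> {hd (D (edge k)), last (D (edge k))} = pt ` \<mu> ` edge k \<and>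
      set (bends (D (edge k))) = {corner (?l k)} \<and> length (bends (D (edge k))) \<le> 1"
    if k: "k < m" for k
  proof -
    note v = va_ho[OF L(2)[OF k]]
    have "pos (va (?l k)) \<noteq> corner (?l k)" "corner (?l k) \<noteq> pos (ho (?l k))"
      using coords_inj[OF v(1,2,3)] by (auto simp: pos_def corner_def)
    moreover have "pt ` \<mu> ` edge k = {pos (va (?l k)), pos (ho (?l k))}"
      using pt_pos v edge_lit[OF k L(3)[OF k]] by simp
    ultimately show ?thesis
      using D[OF k] by (auto simp: draws_def polygonal_chain_def segments_def bends_def)
  qed
  have avoid: "pt (\<mu> v) \<notin> chain_image (D (edge k))" if k: "k < m" and v: "v \<in> V - edge k" for k v
  proof
    assume p: "pt (\<mu> v) \<in> chain_image (D (edge k))"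
    obtain u where u: "u < n" "v = vs ! u" using v vertices(2) by (metis DiffD1 in_set_conv_nth)
    note w = va_ho[OF L(2)[OF k]]
    have "x u = x (va (?l k)) \<or> y u = y (ho (?l k))"
      using p unfolding draws_image[OF D[OF k]] u(2) pt_pos[OF u(1)]
      by (auto simp: vseg_eq hseg_eq pos_def)
    then have "u = va (?l k) \<or> u = ho (?l k)" using coords_inj u(1) w by blast
    then show False using v u edge_lit[OF k L(3)[OF k]] by auto
  qed
  \<comment> \<open>A common point of two parallel segments would be a common end vertex, which is
    excluded; so one segment is vertical and the other horizontal. This also covers contacts at a
    bend.\<close>
  have perp: "(b - a) \<bullet> (d - c) = 0"
    if ij: "i < m" "j < m" "edge i \<noteq> edge j"
      and ab: "(a, b) \<in> set (segments (D (edge i)))" and cd: "(c, d) \<in> set (segments (D (edge j)))"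
      and p: "p \<in> closed_segment a b" "p \<in> closed_segment c d" "p \<notin> pt ` \<mu> ` (edge i \<inter> edge j)"
    for i j a b c d p
  proof -
    have "i \<noteq> j" using ij by blast
    note ml = L(2)[OF ij(1)] L(2)[OF ij(2)] ne[OF ij(1,2) this] ncf[OF ij(1,2)]
    note ei = edge_lit[OF ij(1) L(3)[OF ij(1)]] and ej = edge_lit[OF ij(2) L(3)[OF ij(2)]]
    have common: "p \<noteq> pos u" if "vs ! u \<in> edge i" "vs ! u \<in> edge j" "u < n" for u
      using p(3) that pt_pos[OF that(3)] by force
    have "\<not> (p \<in> vseg (?l i) \<and> p \<in> vseg (?l j))"
      using vseg_meet[OF ml, of p] common[of "va (?l i)"] va_ho(1)[OF ml(1)] ei ej by auto
    moreover have "\<not> (p \<in> hseg (?l i) \<and> p \<in> hseg (?l j))"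
      using hseg_meet[OF ml, of p] common[of "ho (?l i)"] va_ho(2)[OF ml(1)] ei ej by auto
    ultimately show ?thesis
      using draws_segment[OF D[OF ij(1)] ab] draws_segment[OF D[OF ij(2)] cd] p(1,2)
      by (auto simp: inner_prod_def)
  qed
  have axis: "fst a = fst b \<or> snd a = snd b"
    if "k < m" "(a, b) \<in> set (segments (D (edge k)))" for k a b
    using draws_segment[OF D[OF that(1)] that(2)] by auto
  have "right_angle_crossings E \<mu> D"
    unfolding right_angle_crossings_def edges using perp by fast
  moreover have "\<not> overlap (D (edge i)) (D (edge j))" if "i < m" "j < m" "edge i \<noteq> edge j" for i j
    using no_overlap[OF L(2)[OF that(1)] L(2)[OF that(2)] ne ncf D D] that by blast
  then have "point_set_embedding V E S \<mu> D"
    using bij chain avoid unfolding point_set_embedding_def edges by simp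
  moreover have "\<forall>e\<in>E. (\<forall>b\<in>set (bends (D e)). fst b \<in> \<int> \<and> snd b \<in> \<int>) \<and>
      (\<forall>(a, b)\<in>set (segments (D e)). fst a = fst b \<or> snd a = snd b) \<and> length (bends (D e)) \<le> 1"
    unfolding edges
  proof (intro ballI)
    fix e assume "e \<in> edge ` {..<m}"
    then obtain k where k: "k < m" "e = edge k" by auto
    have "\<forall>(a, b)\<in>set (segments (D e)). fst a = fst b \<or> snd a = snd b"
      using axis[OF k(1)] k(2) by blast
    with chain[OF k(1)] k(2) show "(\<forall>b\<in>set (bends (D e)). fst b \<in> \<int> \<and> snd b \<in> \<int>) \<and>
      (\<forall>(a, b)\<in>set (segments (D e)). fst a = fst b \<or> snd a = snd b) \<and> length (bends (D e)) \<le> 1"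
      by (simp add: corner_def)
  qed
  ultimately show ?thesis unfolding restricted_RAC1_embedding_def by simp
qed

text \<open>The ends of an edge differ in both coordinates, so a straight chain is impossible and
  there is exactly one bend.\<close>

lemma draws_if_embedding:
  assumes "restricted_RAC1_embedding V E S \<mu> D" and k: "k < m"
  obtains l where "l = k \<or> l = k + m" "draws l (D (edge k))"
proof -
  let ?ps = "D (edge k)"
  have "edge k \<in> E" using edges k by blast
  then have len: "length ?ps \<ge> 2" and ends: "{hd ?ps, last ?ps} = pt ` \<mu> ` edge k"
    and b: "length (bends ?ps) \<le> 1"
    and seg: "\<And>a b. (a, b) \<in> set (segments ?ps) \<Longrightarrow> fst a = fst b \<or> snd a = snd b"
    using assms unfolding restricted_RAC1_embedding_def point_set_embedding_def polygonal_chain_def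
    by auto
  let ?s = "sr k" and ?d = "ds k"
  have ends': "{hd ?ps, last ?ps} = {pos ?s, pos ?d}"
    unfolding ends using pt_pos ends_less[OF k] by (simp add: edge_eq[OF k])
  note ne = coords_inj[OF ends_less[OF k] ends_neq[OF k]]
  have "length ?ps \<le> 3" using b by (simp add: bends_def)
  with len consider p q where "?ps = [p, q]" | p c q where "?ps = [p, c, q]"
    by (cases ?ps rule: list.exhaust; cases "tl ?ps"; cases "tl (tl ?ps)"; cases "tl (tl (tl ?ps))") auto
  then show ?thesis
  proof cases
    case (1 p q)
    then have "fst p = fst q \<or> snd p = snd q" using seg[of p q] by (simp add: segments_def)
    moreover have "{p, q} = {pos ?s, pos ?d}" using ends' 1 by simp
    ultimately show ?thesis using ne by (auto simp: doubleton_eq_iff pos_def)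
  next
    case (2 p c q)
    then have pc: "fst p = fst c \<or> snd p = snd c" and cq: "fst c = fst q \<or> snd c = snd q"
      using seg[of p c] seg[of c q] by (simp_all add: segments_def)
    have pq: "{p, q} = {pos ?s, pos ?d}" using ends' 2 by simp
    then have "fst p \<noteq> fst q" "snd p \<noteq> snd q" using ne by (auto simp: doubleton_eq_iff pos_def)
    \<comment> \<open>Two segments of the same orientation would give the ends a common coordinate.
      One is vertical, the other horizontal, and this fixes the bend.\<close>
    with pc cq have c: "c = (fst p, snd q) \<or> c = (fst q, snd p)" by (auto simp: prod_eq_iff)
    have lits: "va k = ?s" "ho k = ?d" "va (k + m) = ?d" "ho (k + m) = ?s"
      using k by (simp_all add: va_def ho_def)
    have "draws k ?ps \<or> draws (k + m) ?ps"
      using pq c unfolding draws_def 2 lits corner_def by (auto simp: doubleton_eq_iff pos_def)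
    then show ?thesis using that by blast
  qed
qed

lemma solves_if_embedding:
  assumes D: "restricted_RAC1_embedding V E S \<mu> D"
  shows "\<exists>X. solves X"
proof -
  have "\<forall>k<m. \<exists>l. (l = k \<or> l = k + m) \<and> draws l (D (edge k))"
    using draws_if_embedding[OF D] by metis
  then obtain L where L: "\<And>k. k < m \<Longrightarrow> L k = k \<or> L k = k + m"
    "\<And>k. k < m \<Longrightarrow> draws (L k) (D (edge k))"
    by metis
  let ?X = "L ` {..<m}"
  have "?X \<subseteq> {..<N}" using L(1) by force
  moreover have "ng l \<in> ?X \<longleftrightarrow> l \<notin> ?X" if "l < N" for l
  proof -
    \<comment> \<open>A literal determines its edge: \<open>L j\<close> is \<open>j\<close> or
      \<open>j + m\<close> with \<open>j < m\<close>, so \<open>k\<close> and \<open>k + m\<close>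
      can only come from index \<open>k\<close>.\<close>
    have k: "k \<in> ?X \<longleftrightarrow> L k = k" "k + m \<in> ?X \<longleftrightarrow> L k = k + m" if "k < m" for k
    proof -
      show "k \<in> ?X \<longleftrightarrow> L k = k"
      proof
        assume "k \<in> ?X"
        then obtain j where "j < m" "k = L j" by auto
        with L(1)[of j] that show "L k = k" by auto
      next
        assume "L k = k"
        with that show "k \<in> ?X" by (metis imageI lessThan_iff)
      qed
      show "k + m \<in> ?X \<longleftrightarrow> L k = k + m"
      proof
        assume "k + m \<in> ?X"
        then obtain j where "j < m" "k + m = L j" by auto
        with L(1)[of j] that show "L k = k + m" by auto
      next
        assume "L k = k + m"
        with that show "k + m \<in> ?X" by (metis imageI lessThan_iff)
      qed
    qed
    show ?thesis
    proof (cases "l < m")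
      case True
      then show ?thesis using k[OF True] L(1)[OF True] by (auto simp: ng_def simp del: image_iff)
    next
      case False
      then have "l - m < m" "l - m + m = l" using that by auto
      with False show ?thesis
        using k[of "l - m"] L(1)[of "l - m"] by (auto simp: ng_def simp del: image_iff)
    qed
  qed
  moreover have "\<not> cf a b" if ab: "a \<in> ?X" "b \<in> ?X" for a b
  proof
    assume cf: "cf a b"
    obtain i j where ij: "i < m" "j < m" "a = L i" "b = L j" using ab by auto
    then have "i \<noteq> j" using cf by (auto simp: cf_def)
    then have "edge i \<noteq> edge j" using edge_inj ij by (auto simp: inj_on_def)
    then have "\<not> overlap (D (edge i)) (D (edge j))"
      using D ij edges unfolding restricted_RAC1_embedding_def point_set_embedding_def by blast
    moreover have "overlap (D (edge i)) (D (edge j))"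
      using overlap_if_cf[OF cf] L(2) ij by blast
    ultimately show False by blast
  qed
  ultimately have "solves ?X" unfolding solves_def by blast
  then show ?thesis by blast
qed

lemma draws_output:
  assumes "bends_set m X s" "k < m"
  shows "draws (lit_of X k) (output_drawing \<mu> vs es s (edge k))"
proof -
  have "(THE j. j < m \<and> edge j = edge k) = k"
    using assms(2) edge_inj by (intro the_equality) (auto simp: inj_on_def)
  then have "output_drawing \<mu> vs es s (edge k) = [pos (sr k), corner (lit_of X k), pos (ds k)]"
    using assms pt_pos ends_less
    by (simp add: output_drawing_def output_chain_def bends_set_def lit_of_def corner_def
        pt_def sr_ds[symmetric])
  then show ?thesis
    using assms(2) by (auto simp: draws_def lit_of_def va_def ho_def)
qed

section \<open>Word size and the final assembly\<close>

lemma input_values: "values_le (2 * n) (input_state \<mu> vs es)"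
proof -
  have "x u \<le> n" "y u \<le> n" for u
  proof -
    have S: "S \<subseteq> {1..n} \<times> {1..n}" using grid n_card by (simp add: grid_point_set_def)
    have "fst (\<mu> (vs ! u)) \<le> n \<and> snd (\<mu> (vs ! u)) \<le> n" if "u < n"
    proof -
      have "\<mu> (vs ! u) \<in> S" by (rule bij_betw_apply[OF bij vertices(1)[OF that]])
      with S have "\<mu> (vs ! u) \<in> {1..n} \<times> {1..n}" by (rule subsetD)
      then show ?thesis by (simp add: mem_Times_iff)
    qed
    then show "x u \<le> n" "y u \<le> n" by (simp_all add: array_of_def)
  qed
  moreover have "sr k \<le> n" "ds k \<le> n" for k
    using ends_less[of k] by (cases "k < m"; simp add: array_of_def)+
  ultimately have "x u \<le> 2 * n" "y u \<le> 2 * n" "sr u \<le> 2 * n" "ds u \<le> 2 * n" for u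
    by (simp_all add: trans_le_add1 mult_2)
  then show ?thesis
    using edge_count unfolding values_le_def input_state_def by simp
qed

text \<open>The word size has to cover \<open>2 * n + (2 * n + 1) * t\<close>. In the exponent, two
  factors \<open>2 * n + 1\<close> account for 4, the constant \<open>total_time\<close> for itself,
  and adding \<open>2 * n\<close> for 1. The base \<open>n + 2\<close> is at least 2 even for
  \<open>n = 0\<close>, which \<open>total_time \<le> 2 ^ total_time\<close> requires.\<close>

lemma program_correct:
  "\<exists>t s. exec ((n + 2) ^ (total_time + 5)) program (input_state \<mu> vs es) t s \<and>
     t \<le> (2 * n + 1) * total_time \<and>
     (accepts s \<longleftrightarrow> (\<exists>D. restricted_RAC1_embedding V E S \<mu> D)) \<and>
     (accepts s \<longrightarrow> restricted_RAC1_embedding V E S \<mu> (output_drawing \<mu> vs es s))"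
proof -
  let ?s = "input_state \<mu> vs es" and ?w = "(n + 2) ^ (total_time + 5)"
  have "ok program ?s (\<lambda>t s'. t \<le> (m + 1) * total_time \<and>
    (fst s' ''ans'' = 1 \<and> (\<exists>X. solves X \<and> bends_set m X s') \<or> fst s' ''ans'' = 0 \<and> (\<nexists>X. solves X)))"
    by (rule ok_program) (auto simp: input_state_def data_def)
  then obtain w t s where ex: "exec w program ?s t s" and t: "t \<le> (m + 1) * total_time"
    and res: "fst s ''ans'' = 1 \<and> (\<exists>X. solves X \<and> bends_set m X s) \<or>
      fst s ''ans'' = 0 \<and> (\<nexists>X. solves X)"
    unfolding ok_def by blast
  have "(m + 1) * total_time \<le> (2 * n + 1) * total_time"
    using edge_count by (intro mult_le_mono1) simp
  with t have t': "t \<le> (2 * n + 1) * total_time" by (rule order_trans)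
  have "2 * n + (2 * n + 1) * t \<le> ?w"
  proof -
    have C: "total_time \<le> (n + 2) ^ total_time"
    proof -
      have "total_time \<le> 2 ^ total_time" by (rule less_imp_le[OF less_exp])
      also have "\<dots> \<le> (n + 2) ^ total_time" by (rule power_mono) simp_all
      finally show ?thesis .
    qed
    have q: "2 * n + 1 \<le> (n + 2) ^ 2" by (simp add: power2_eq_square)
    have "(2 * n + 1) * t \<le> (2 * n + 1) * ((2 * n + 1) * total_time)"
      using t' by (rule mult_le_mono2)
    also have "\<dots> \<le> (n + 2) ^ 2 * ((n + 2) ^ 2 * (n + 2) ^ total_time)"
      by (intro mult_le_mono q C)
    also have "\<dots> = (n + 2) ^ (2 + (2 + total_time))" by (simp only: power_add)
    also have "2 + (2 + total_time) = total_time + 4" by simp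
    finally have "(2 * n + 1) * t \<le> (n + 2) ^ (total_time + 4)" .
    moreover have "2 * n \<le> (n + 2) ^ (total_time + 4)"
    proof -
      have "(n + 2) ^ 2 \<le> (n + 2) ^ (total_time + 4)" by (rule power_increasing) auto
      with q show ?thesis by linarith
    qed
    moreover have "2 * (n + 2) ^ (total_time + 4) \<le> ?w"
    proof -
      have "2 * (n + 2) ^ (total_time + 4) \<le> (n + 2) * (n + 2) ^ (total_time + 4)"
        by (rule mult_le_mono1) simp
      also have "\<dots> = ?w" by (simp only: power_Suc[symmetric]) simp
      finally show ?thesis .
    qed
    ultimately show ?thesis by linarith
  qed
  then have "exec ?w program ?s t s"
    using exec_tame[OF ex tame_program input_values, of "2 * n + 1" ?w] edge_count
    by (simp add: input_state_def)
  moreover have "accepts s \<longleftrightarrow> (\<exists>X. solves X)" using res by (auto simp: accepts_def)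
  moreover have "restricted_RAC1_embedding V E S \<mu> (output_drawing \<mu> vs es s)" if "accepts s"
  proof -
    obtain X where X: "solves X" "bends_set m X s" using res \<open>accepts s\<close> by (auto simp: accepts_def)
    show ?thesis by (rule embedding_if_draws[OF X(1) draws_output[OF X(2)]])
  qed
  ultimately show ?thesis using t' solves_if_embedding by blast
qed

end

theorem theorem3:
  shows "\<exists>(P :: com) (k :: nat) (T :: nat \<Rightarrow> nat).
    (\<lambda>n. real (T n)) \<in> O(\<lambda>n. real n) \<and>
    (\<forall>(n :: nat) (V :: 'v set) (E :: 'v set set) (S :: (nat \<times> nat) set) (\<mu> :: 'v \<Rightarrow> nat \<times> nat)
      (vs :: 'v list) (es :: (nat \<times> nat) list).
      simple_graph V E \<and> card V = n \<and> (\<forall>v\<in>V. vertex_degree E v \<le> 4) \<and>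
      grid_point_set n S \<and> bij_betw \<mu> V S \<and> graph_encoding V E vs es \<longrightarrow>
      (\<exists>t s. exec ((n + 2) ^ k) P (input_state \<mu> vs es) t s \<and> t \<le> T n \<and>
        (accepts s \<longleftrightarrow> (\<exists>D. restricted_RAC1_embedding V E S \<mu> D)) \<and>
        (accepts s \<longrightarrow> restricted_RAC1_embedding V E S \<mu> (output_drawing \<mu> vs es s))))"
proof -
  have "(\<lambda>n. real ((2 * n + 1) * total_time)) \<in> O(\<lambda>n. real n)"
  \<comment> \<open>The 3 absorbs the additive constant: \<open>2 * n + 1 \<le> 3 * n\<close> for
    positive \<open>n\<close>.\<close>
  proof (rule bigoI[of _ "3 * real total_time"], rule eventually_mono[OF eventually_ge_at_top[of 1]])
    fix n :: nat assume "1 \<le> n"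
    then have "(2 * n + 1) * total_time \<le> 3 * n * total_time" by (intro mult_le_mono1) simp
    then have "real ((2 * n + 1) * total_time) \<le> real (3 * n * total_time)" by (rule of_nat_mono)
    then show "norm (real ((2 * n + 1) * total_time)) \<le> 3 * real total_time * norm (real n)"
      by (simp add: mult_ac)
  qed
  moreover have "\<exists>t s. exec ((n + 2) ^ (total_time + 5)) program (input_state \<mu> vs es) t s \<and>
      t \<le> (2 * n + 1) * total_time \<and>
      (accepts s \<longleftrightarrow> (\<exists>D. restricted_RAC1_embedding V E S \<mu> D)) \<and>
      (accepts s \<longrightarrow> restricted_RAC1_embedding V E S \<mu> (output_drawing \<mu> vs es s))"
    if "simple_graph V E \<and> card V = n \<and> (\<forall>v\<in>V. vertex_degree E v \<le> 4) \<and>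
      grid_point_set n S \<and> bij_betw \<mu> V S \<and> graph_encoding V E vs es"
    for n and V :: "'v set" and E S \<mu> vs es
  proof -
    interpret drawing_instance V E S \<mu> vs es
      using that by unfold_locales auto
    show ?thesis using program_correct n_card that by simp
  qed
  ultimately show ?thesis
    by (intro exI[of _ program] exI[of _ "total_time + 5"] exI[of _ "\<lambda>n. (2 * n + 1) * total_time"])
      simp
qed

end
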